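(* Let $\Bbbk$, $A$, $f$, $A_f$ be as in the context. Let $M$ be an $A$-module and let $$\cdots\to Q_1\xrightarrow{\delta_1}Q_0\xrightarrow{\delta_0}M\to0$$ be a minimal projective resolution of $M$ satisfying condition $(\ast B)$. Then $$\cdots\to\hat Q_m\xrightarrow{\hat\delta_m}\hat Q_{m-1}\to\cdots\to\hat Q_1\xrightarrow{\hat\delta_1}\hat Q_0\xrightarrow{\hat\delta_0}M\to0$$ is a minimal projective resolution of the $A_f$-module $M=(0,M,0,0)$, where $\hat\delta_{2i}=(0,\delta_{2i},0)$ and $\hat\delta_{2i+1}=(\delta_{2i+1},T_{\delta_{2i+1}},\delta_{2i+1})$ for $i\ge0$.
   Context: Setting. $\Bbbk$ is an algebraically closed field, $A$ a finite dimensional associative unital $\Bbbk$-algebra, all modules are finite dimensional left modules. $1=\sum_{i=1}^n e_i$ is a decomposition into primitive orthogonal idempotents such that $P_i=Ae_i$ form a complete set of representatives of isomorphism classes of indecomposable projective $A$-modules. $f\colon A\otimes_\Bbbk A\to A$ is a Hochschild $2$-cocycle: $af(b\otimes c)-f(ab\otimes c)+f(a\otimes bc)-f(a\otimes b)c=0$. $A_f=A[t]/(t^2)\simeq A\oplus A$ is the algebra with product $(a_0+a_1t)(b_0+b_1t)=a_0b_0+(a_0b_1+a_1b_0+f(a_0\otimes b_0))t$. $A_f$-modules. $\operatorname{mod}A_f$ is identified with the category of tuples $(M_0,M_1,T_M,f_M)$, $M_0,M_1\in\operatorname{mod}A$, $T_M\in\operatorname{Hom}_A(M_0,M_1)$ a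 monomorphism, $f_M\in\operatorname{Hom}_\Bbbk(A\otimes_\Bbbk M_0,M_1)$ with $af_M(b\otimes m)-f_M(ab\otimes m)+f_M(a\otimes bm)-f(a\otimes b)T_M(m)=0$; the tuple corresponds to $M_0\oplus M_1$ with $(a+bt)(m_0,m_1)=(am_0,\,am_1+bT_M(m_0)+f_M(a\otimes m_0))$. Morphisms $(M_0,M_1,T_M,f_M)\to(N_0,N_1,T_N,f_N)$ are triples $(u_0,u_1,u_2)$, $u_0\in\operatorname{Hom}_A(M_0,N_0)$, $u_2\in\operatorname{Hom}_A(M_1,N_1)$, $u_1\in\operatorname{Hom}_\Bbbk(M_0,N_1)$, with $T_Nu_0=u_2T_M$ and $u_1(am)=au_1(m)-u_2(f_M(a\otimes m))+f_N(a\otimes u_0(m))$, corresponding to $(m_0,m_1)\mapsto(u_0(m_0),u_1(m_0)+u_2(m_1))$; composition is $(v_0,v_1,v_2)(u_0,u_1,u_2)=(v_0u_0,\,v_2u_1+v_1u_0,\,v_2u_2)$. An $A$-module $M$ is viewed as the $A_f$-module $(0,M,0,0)$. Projectives. Every projective $A$-module $Q$ is taken with a decomposition $Q=\bigoplus_{r=1}^m Ae_{i_r}$; for $x=\sum x_r\in Q$, $x_r\in Ae_{i_r}$, write $[x]=[x_1\cdots x_m]$; $E\in M_m(A)$ is the diagonal matrix with entries $e_{i_1},\dots,e_{i_m}$. $f_Q\colon A\otimes Q\to Q$ is $f_Q(a\otimes x)=\sum_r f(a\otimes x_r)e_{i_r}$, and $\hat Q=(Q,Q,\mathrm{Id},f_Q)$,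 a projective $A_f$-module. A morphism $\delta\colon Q\to Q'$ of projective $A$-modules is given by a matrix $B$ with $EBE'=B$ via $[\delta(x)]=[x]B$. For matrices over $A$ of compatible sizes, $\tilde f(B\otimes B')_{ij}=\sum_l f(b_{il}\otimes b'_{lj})$. Condition $(\ast B)$ for a minimal projective resolution $\cdots\to Q_1\xrightarrow{\delta_1}Q_0\xrightarrow{\delta_0}M\to0$: let $B_{i+1}$ be the matrix of $\delta_{i+1}\colon Q_{i+1}\to Q_i$, $E_i$ the diagonal matrix of $Q_i$, and $T_{\delta_{i+1}}\colon Q_{i+1}\to Q_i$ the linear map $[T_{\delta_{i+1}}(x)]=\tilde f([x]\otimes B_{i+1})E_i$. Then for every $i\ge0$: (i) $\delta_{2i}T_{\delta_{2i+1}}$ restricted to $\operatorname{Ker}\delta_{2i+1}$ is injective; (ii) $Q_{2i}=T_{\delta_{2i+1}}(\operatorname{Ker}\delta_{2i+1})\oplus\operatorname{Im}\delta_{2i+1}$ as $\Bbbk$-vector spaces. *)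

theory Defs
  imports "HOL-Algebra.Algebra"
begin

section \<open>Algebras and left modules\<close>

text \<open>The locale \<^locale>\<open>module\<close> of \<^theory>\<open>HOL-Algebra.Module\<close> requires commutative scalars; this
  is the same notion for left modules over an arbitrary ring. The fields \<open>mult\<close> and \<open>one\<close> of the
  record \<open>M\<close> are irrelevant.\<close>

locale left_module = R?: ring R + M?: abelian_group M
  for R :: "('a, 'b) ring_scheme" (structure) and M :: "('a, 'c, 'd) module_scheme" (structure) +
  assumes smult_closed:
      "\<lbrakk>a \<in> carrier R; x \<in> carrier M\<rbrakk> \<Longrightarrow> a \<odot>\<^bsub>M\<^esub> x \<in> carrier M"
    and smult_l_distr:
      "\<lbrakk>a \<in> carrier R; b \<in> carrier R; x \<in> carrier M\<rbrakk> \<Longrightarrow>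
        (a \<oplus> b) \<odot>\<^bsub>M\<^esub> x = a \<odot>\<^bsub>M\<^esub> x \<oplus>\<^bsub>M\<^esub> b \<odot>\<^bsub>M\<^esub> x"
    and smult_r_distr:
      "\<lbrakk>a \<in> carrier R; x \<in> carrier M; y \<in> carrier M\<rbrakk> \<Longrightarrow>
        a \<odot>\<^bsub>M\<^esub> (x \<oplus>\<^bsub>M\<^esub> y) = a \<odot>\<^bsub>M\<^esub> x \<oplus>\<^bsub>M\<^esub> a \<odot>\<^bsub>M\<^esub> y"
    and smult_assoc1:
      "\<lbrakk>a \<in> carrier R; b \<in> carrier R; x \<in> carrier M\<rbrakk> \<Longrightarrow>
        (a \<otimes> b) \<odot>\<^bsub>M\<^esub> x = a \<odot>\<^bsub>M\<^esub> (b \<odot>\<^bsub>M\<^esub> x)"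
    and smult_one: "x \<in> carrier M \<Longrightarrow> \<one> \<odot>\<^bsub>M\<^esub> x = x"

definition finite_dim :: "'k ring \<Rightarrow> ('k, 'v) module \<Rightarrow> bool" where
  "finite_dim K V \<longleftrightarrow>
     (\<exists>S \<subseteq> carrier V. finite S \<and>
        (\<forall>v \<in> carrier V. \<exists>c \<in> S \<rightarrow> carrier K. v = (\<Oplus>\<^bsub>V\<^esub> s \<in> S. c s \<odot>\<^bsub>V\<^esub> s)))"

text \<open>Associative unital, not necessarily commutative (in contrast to \<^locale>\<open>algebra\<close>).\<close>

definition fd_algebra :: "'k ring \<Rightarrow> ('k, 'a) module \<Rightarrow> bool" where
  "fd_algebra K A \<longleftrightarrow>
     field K \<and> ring A \<and> module K A \<and> finite_dim K A \<and>
     (\<forall>c \<in> carrier K. \<forall>a \<in> carrier A. \<forall>b \<in> carrier A.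
        (c \<odot>\<^bsub>A\<^esub> a) \<otimes>\<^bsub>A\<^esub> b = c \<odot>\<^bsub>A\<^esub> (a \<otimes>\<^bsub>A\<^esub> b) \<and>
        a \<otimes>\<^bsub>A\<^esub> (c \<odot>\<^bsub>A\<^esub> b) = c \<odot>\<^bsub>A\<^esub> (a \<otimes>\<^bsub>A\<^esub> b))"

text \<open>The vector space underlying a module over a \<open>K\<close>-algebra \<open>A\<close>.\<close>

definition restrict_scalars :: "('k, 'a) module \<Rightarrow> ('a, 'x) module \<Rightarrow> ('k, 'x) module" where
  "restrict_scalars A W =
     \<lparr>carrier = carrier W, monoid.mult = monoid.mult W, one = one W,
      ring.zero = ring.zero W, ring.add = ring.add W,
      smult = (\<lambda>c x. (c \<odot>\<^bsub>A\<^esub> \<one>\<^bsub>A\<^esub>) \<odot>\<^bsub>W\<^esub> x)\<rparr>"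

definition fd_module :: "'k ring \<Rightarrow> ('k, 'a) module \<Rightarrow> ('a, 'x) module \<Rightarrow> bool" where
  "fd_module K A W \<longleftrightarrow> left_module A W \<and> finite_dim K (restrict_scalars A W)"

definition mod_hom ::
    "('a, 'b) ring_scheme \<Rightarrow> ('a, 'x) module \<Rightarrow> ('a, 'y) module \<Rightarrow> ('x \<Rightarrow> 'y) set" where
  "mod_hom R W Y =
     {h \<in> hom (add_monoid W) (add_monoid Y).
        \<forall>a \<in> carrier R. \<forall>x \<in> carrier W. h (a \<odot>\<^bsub>W\<^esub> x) = a \<odot>\<^bsub>Y\<^esub> h x}"

definition mod_iso :: "('a, 'b) ring_scheme \<Rightarrow> ('a, 'x) module \<Rightarrow> ('a, 'y) module \<Rightarrow> bool" where
  "mod_iso R W Y \<longleftrightarrow> (\<exists>h \<in> mod_hom R W Y. bij_betw h (carrier W) (carrier Y))"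

text \<open>Linear maps \<open>U \<otimes>\<^sub>K V \<rightarrow> W\<close> are given as bilinear maps; \<open>\<phi> u v\<close> is the value at \<open>u \<otimes> v\<close>.\<close>

definition bilinear_map ::
    "'k ring \<Rightarrow> ('k, 'u) module \<Rightarrow> ('k, 'v) module \<Rightarrow> ('k, 'w) module \<Rightarrow> ('u \<Rightarrow> 'v \<Rightarrow> 'w) \<Rightarrow> bool"
  where
  "bilinear_map K U V W \<phi> \<longleftrightarrow>
     (\<forall>u \<in> carrier U. \<phi> u \<in> mod_hom K V W) \<and>
     (\<forall>v \<in> carrier V. (\<lambda>u. \<phi> u v) \<in> mod_hom K U W)"


section \<open>Projective modules and minimal projective resolutions\<close>

text \<open>Projectivity in the category of finite dimensional modules. The type \<open>nat \<Rightarrow> 'k\<close> of the test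
  modules is no restriction: every finite dimensional module is isomorphic to one with underlying
  set \<open>K\<^sup>d\<close>, embedded in \<open>nat \<Rightarrow> 'k\<close>.\<close>

definition projective :: "'k ring \<Rightarrow> ('k, 'a) module \<Rightarrow> ('a, 'p) module \<Rightarrow> bool" where
  "projective K A P \<longleftrightarrow>
     fd_module K A P \<and>
     (\<forall>(W :: ('a, nat \<Rightarrow> 'k) module) (Y :: ('a, nat \<Rightarrow> 'k) module) g h.
        fd_module K A W \<longrightarrow> fd_module K A Y \<longrightarrow>
        g \<in> mod_hom A W Y \<longrightarrow> g ` carrier W = carrier Y \<longrightarrow> h \<in> mod_hom A P Y \<longrightarrow>
        (\<exists>h' \<in> mod_hom A P W. \<forall>p \<in> carrier P. g (h' p) = h p))"

definition indecomposable :: "('k, 'a) module \<Rightarrow> ('a, 'x) module \<Rightarrow> bool" where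
  "indecomposable A W \<longleftrightarrow>
     carrier W \<noteq> {\<zero>\<^bsub>W\<^esub>} \<and>
     (\<forall>U V. submodule U A W \<longrightarrow> submodule V A W \<longrightarrow>
        U <+>\<^bsub>W\<^esub> V = carrier W \<longrightarrow> U \<inter> V = {\<zero>\<^bsub>W\<^esub>} \<longrightarrow> U = {\<zero>\<^bsub>W\<^esub>} \<or> V = {\<zero>\<^bsub>W\<^esub>})"

definition superfluous :: "('k, 'a) module \<Rightarrow> ('a, 'x) module \<Rightarrow> 'x set \<Rightarrow> bool" where
  "superfluous A W N \<longleftrightarrow>
     submodule N A W \<and>
     (\<forall>L. submodule L A W \<longrightarrow> L <+>\<^bsub>W\<^esub> N = carrier W \<longrightarrow> L = carrier W)"

definition projective_cover ::
    "'k ring \<Rightarrow> ('k, 'a) module \<Rightarrow> ('a, 'p) module \<Rightarrow> ('a, 'x) module \<Rightarrow> ('p \<Rightarrow> 'x) \<Rightarrow> bool" where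
  "projective_cover K A P W h \<longleftrightarrow>
     projective K A P \<and> h \<in> mod_hom A P W \<and> h ` carrier P = carrier W \<and>
     superfluous A P (a_kernel P W h)"

text \<open>A resolution of \<open>M\<close> consists of modules \<open>P i\<close>, maps \<open>\<delta> i : P i \<rightarrow> P (i - 1)\<close> for \<open>i \<ge> 1\<close>
  (the value \<open>\<delta> 0\<close> is not used) and the augmentation \<open>\<delta>0 : P 0 \<rightarrow> M\<close>, which has to be kept apart
  because the underlying type of \<open>M\<close> may differ from that of the \<open>P i\<close>.\<close>

definition projective_resolution ::
    "'k ring \<Rightarrow> ('k, 'a) module \<Rightarrow> (nat \<Rightarrow> ('a, 'p) module) \<Rightarrow> (nat \<Rightarrow> 'p \<Rightarrow> 'p) \<Rightarrow> ('p \<Rightarrow> 'm) \<Rightarrow>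
      ('a, 'm) module \<Rightarrow> bool" where
  "projective_resolution K A P \<delta> \<delta>0 M \<longleftrightarrow>
     fd_module K A M \<and> (\<forall>i. projective K A (P i)) \<and>
     \<delta>0 \<in> mod_hom A (P 0) M \<and> (\<forall>i. \<delta> (i + 1) \<in> mod_hom A (P (i + 1)) (P i)) \<and>
     \<delta>0 ` carrier (P 0) = carrier M \<and>
     \<delta> 1 ` carrier (P 1) = a_kernel (P 0) M \<delta>0 \<and>
     (\<forall>i. \<delta> (i + 2) ` carrier (P (i + 2)) = a_kernel (P (i + 1)) (P i) (\<delta> (i + 1)))"

definition minimal_projective_resolution ::
    "'k ring \<Rightarrow> ('k, 'a) module \<Rightarrow> (nat \<Rightarrow> ('a, 'p) module) \<Rightarrow> (nat \<Rightarrow> 'p \<Rightarrow> 'p) \<Rightarrow> ('p \<Rightarrow> 'm) \<Rightarrow>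
      ('a, 'm) module \<Rightarrow> bool" where
  "minimal_projective_resolution K A P \<delta> \<delta>0 M \<longleftrightarrow>
     projective_resolution K A P \<delta> \<delta>0 M \<and>
     projective_cover K A (P 0) M \<delta>0 \<and>
     (\<forall>i. projective_cover K A (P (i + 1))
            (P i\<lparr>carrier := \<delta> (i + 1) ` carrier (P (i + 1))\<rparr>) (\<delta> (i + 1)))"


section \<open>Projective modules given by idempotents\<close>

definition idempotent_elt :: "('k, 'a) module \<Rightarrow> 'a \<Rightarrow> bool" where
  "idempotent_elt A u \<longleftrightarrow> u \<in> carrier A \<and> u \<otimes>\<^bsub>A\<^esub> u = u"

definition orthogonal_elts :: "('k, 'a) module \<Rightarrow> 'a \<Rightarrow> 'a \<Rightarrow> bool" where
  "orthogonal_elts A u v \<longleftrightarrow> u \<otimes>\<^bsub>A\<^esub> v = \<zero>\<^bsub>A\<^esub> \<and> v \<otimes>\<^bsub>A\<^esub> u = \<zero>\<^bsub>A\<^esub>"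

definition primitive_idempotent :: "('k, 'a) module \<Rightarrow> 'a \<Rightarrow> bool" where
  "primitive_idempotent A u \<longleftrightarrow>
     idempotent_elt A u \<and> u \<noteq> \<zero>\<^bsub>A\<^esub> \<and>
     (\<forall>v w. idempotent_elt A v \<longrightarrow> idempotent_elt A w \<longrightarrow> orthogonal_elts A v w \<longrightarrow>
        u = v \<oplus>\<^bsub>A\<^esub> w \<longrightarrow> v = \<zero>\<^bsub>A\<^esub> \<or> w = \<zero>\<^bsub>A\<^esub>)"

text \<open>The left module \<open>A u\<close>.\<close>

definition cyclic_left :: "('k, 'a) module \<Rightarrow> 'a \<Rightarrow> ('a, 'a) module" where
  "cyclic_left A u =
     \<lparr>carrier = (\<lambda>a. a \<otimes>\<^bsub>A\<^esub> u) ` carrier A, monoid.mult = monoid.mult A, one = one A,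
      ring.zero = ring.zero A, ring.add = ring.add A, smult = monoid.mult A\<rparr>"

text \<open>\<open>1 = e\<^sub>1 + \<dots> + e\<^sub>n\<close> with primitive orthogonal idempotents such that the \<open>A e\<^sub>i\<close> represent the
  isomorphism classes of indecomposable projectives, without repetition.\<close>

definition basic_decomposition ::
    "'k ring \<Rightarrow> ('k, 'a) module \<Rightarrow> nat \<Rightarrow> (nat \<Rightarrow> 'a) \<Rightarrow> bool" where
  "basic_decomposition K A n e \<longleftrightarrow>
     (\<forall>i \<in> {1..n}. primitive_idempotent A (e i)) \<and>
     (\<forall>i \<in> {1..n}. \<forall>j \<in> {1..n}. i \<noteq> j \<longrightarrow> orthogonal_elts A (e i) (e j)) \<and>
     \<one>\<^bsub>A\<^esub> = (\<Oplus>\<^bsub>A\<^esub> i \<in> {1..n}. e i) \<and>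
     (\<forall>i \<in> {1..n}. projective K A (cyclic_left A (e i)) \<and> indecomposable A (cyclic_left A (e i))) \<and>
     (\<forall>i \<in> {1..n}. \<forall>j \<in> {1..n}.
        mod_iso A (cyclic_left A (e i)) (cyclic_left A (e j)) \<longrightarrow> i = j) \<and>
     (\<forall>W :: ('a, nat \<Rightarrow> 'k) module.
        projective K A W \<and> indecomposable A W \<longrightarrow>
        (\<exists>i \<in> {1..n}. mod_iso A W (cyclic_left A (e i))))"

text \<open>\<open>proj_sum A e [i\<^sub>1, \<dots>, i\<^sub>m]\<close> is \<open>A e\<^bsub>i\<^sub>1\<^esub> \<oplus> \<dots> \<oplus> A e\<^bsub>i\<^sub>m\<^esub>\<close>. Its elements are the rows
  \<open>[x\<^sub>1 \<dots> x\<^sub>m]\<close>, as functions \<open>nat \<Rightarrow> 'a\<close> with positions counted from \<open>0\<close> and value zero from \<open>m\<close> on.\<close>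

definition proj_sum :: "('k, 'a) module \<Rightarrow> (nat \<Rightarrow> 'a) \<Rightarrow> nat list \<Rightarrow> ('a, nat \<Rightarrow> 'a) module" where
  "proj_sum A e js =
     \<lparr>carrier = {x. (\<forall>r < length js. x r \<in> carrier (cyclic_left A (e (js ! r)))) \<and>
                    (\<forall>r \<ge> length js. x r = \<zero>\<^bsub>A\<^esub>)},
      monoid.mult = undefined, one = undefined,
      ring.zero = (\<lambda>_. \<zero>\<^bsub>A\<^esub>), ring.add = (\<lambda>x y r. x r \<oplus>\<^bsub>A\<^esub> y r),
      smult = (\<lambda>a x r. a \<otimes>\<^bsub>A\<^esub> x r)\<rparr>"

text \<open>\<open>B\<close> is the matrix of \<open>\<delta> : Q \<rightarrow> Q'\<close>, that is, \<open>E B E' = B\<close> and \<open>[\<delta>(x)] = [x] B\<close>. The matrices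
  \<open>E\<close> and \<open>E'\<close> are diagonal, so the first equation is stated entrywise.\<close>

definition matrix_of ::
    "('k, 'a) module \<Rightarrow> (nat \<Rightarrow> 'a) \<Rightarrow> nat list \<Rightarrow> nat list \<Rightarrow> ((nat \<Rightarrow> 'a) \<Rightarrow> (nat \<Rightarrow> 'a)) \<Rightarrow>
      (nat \<Rightarrow> nat \<Rightarrow> 'a) \<Rightarrow> bool" where
  "matrix_of A e js js' \<delta> B \<longleftrightarrow>
     (\<forall>l < length js. \<forall>j < length js'.
        B l j \<in> carrier A \<and> e (js ! l) \<otimes>\<^bsub>A\<^esub> B l j \<otimes>\<^bsub>A\<^esub> e (js' ! j) = B l j) \<and>
     (\<forall>x \<in> carrier (proj_sum A e js). \<forall>j < length js'.
        \<delta> x j = (\<Oplus>\<^bsub>A\<^esub> l \<in> {..<length js}. x l \<otimes>\<^bsub>A\<^esub> B l j))"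


section \<open>The deformed algebra and its modules\<close>

definition hochschild_2_cocycle ::
    "'k ring \<Rightarrow> ('k, 'a) module \<Rightarrow> ('a \<Rightarrow> 'a \<Rightarrow> 'a) \<Rightarrow> bool" where
  "hochschild_2_cocycle K A f \<longleftrightarrow>
     bilinear_map K A A A f \<and>
     (\<forall>a \<in> carrier A. \<forall>b \<in> carrier A. \<forall>c \<in> carrier A.
        ((a \<otimes>\<^bsub>A\<^esub> f b c \<ominus>\<^bsub>A\<^esub> f (a \<otimes>\<^bsub>A\<^esub> b) c) \<oplus>\<^bsub>A\<^esub> f a (b \<otimes>\<^bsub>A\<^esub> c)) \<ominus>\<^bsub>A\<^esub> (f a b \<otimes>\<^bsub>A\<^esub> c)
        = \<zero>\<^bsub>A\<^esub>)"

text \<open>\<open>A\<^sub>f\<close>, with \<open>(a\<^sub>0, a\<^sub>1)\<close> standing for \<open>a\<^sub>0 + a\<^sub>1 t\<close>. The cocycle is not assumed to be normalized,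
  so the unit is \<open>1 - f(1 \<otimes> 1) t\<close>.\<close>

definition af_alg :: "('k, 'a) module \<Rightarrow> ('a \<Rightarrow> 'a \<Rightarrow> 'a) \<Rightarrow> ('k, 'a \<times> 'a) module" where
  "af_alg A f =
     \<lparr>carrier = carrier A \<times> carrier A,
      monoid.mult = (\<lambda>(a0, a1) (b0, b1).
        (a0 \<otimes>\<^bsub>A\<^esub> b0, (a0 \<otimes>\<^bsub>A\<^esub> b1 \<oplus>\<^bsub>A\<^esub> a1 \<otimes>\<^bsub>A\<^esub> b0) \<oplus>\<^bsub>A\<^esub> f a0 b0)),
      one = (\<one>\<^bsub>A\<^esub>, \<ominus>\<^bsub>A\<^esub> f \<one>\<^bsub>A\<^esub> \<one>\<^bsub>A\<^esub>),
      ring.zero = (\<zero>\<^bsub>A\<^esub>, \<zero>\<^bsub>A\<^esub>),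
      ring.add = (\<lambda>(a0, a1) (b0, b1). (a0 \<oplus>\<^bsub>A\<^esub> b0, a1 \<oplus>\<^bsub>A\<^esub> b1)),
      smult = (\<lambda>c (a0, a1). (c \<odot>\<^bsub>A\<^esub> a0, c \<odot>\<^bsub>A\<^esub> a1))\<rparr>"

text \<open>Tuples \<open>(M\<^sub>0, M\<^sub>1, T, \<phi>)\<close> describing \<open>A\<^sub>f\<close>-modules, and the corresponding module
  \<open>M\<^sub>0 \<oplus> M\<^sub>1\<close>.\<close>

type_synonym ('a, 'x, 'y) af_tuple =
  "('a, 'x) module \<times> ('a, 'y) module \<times> ('x \<Rightarrow> 'y) \<times> ('a \<Rightarrow> 'x \<Rightarrow> 'y)"

fun af_object ::
    "'k ring \<Rightarrow> ('k, 'a) module \<Rightarrow> ('a \<Rightarrow> 'a \<Rightarrow> 'a) \<Rightarrow> ('a, 'x, 'y) af_tuple \<Rightarrow> bool" where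
  "af_object K A f (M0, M1, T, \<phi>) \<longleftrightarrow>
     fd_module K A M0 \<and> fd_module K A M1 \<and>
     T \<in> mod_hom A M0 M1 \<and> inj_on T (carrier M0) \<and>
     bilinear_map K A (restrict_scalars A M0) (restrict_scalars A M1) \<phi> \<and>
     (\<forall>a \<in> carrier A. \<forall>b \<in> carrier A. \<forall>m \<in> carrier M0.
        ((a \<odot>\<^bsub>M1\<^esub> \<phi> b m \<ominus>\<^bsub>M1\<^esub> \<phi> (a \<otimes>\<^bsub>A\<^esub> b) m) \<oplus>\<^bsub>M1\<^esub> \<phi> a (b \<odot>\<^bsub>M0\<^esub> m)) \<ominus>\<^bsub>M1\<^esub> (f a b \<odot>\<^bsub>M1\<^esub> T m)
        = \<zero>\<^bsub>M1\<^esub>)"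

fun af_module :: "('a, 'x, 'y) af_tuple \<Rightarrow> ('a \<times> 'a, 'x \<times> 'y) module" where
  "af_module (M0, M1, T, \<phi>) =
     \<lparr>carrier = carrier M0 \<times> carrier M1, monoid.mult = undefined, one = undefined,
      ring.zero = (\<zero>\<^bsub>M0\<^esub>, \<zero>\<^bsub>M1\<^esub>),
      ring.add = (\<lambda>(m0, m1) (n0, n1). (m0 \<oplus>\<^bsub>M0\<^esub> n0, m1 \<oplus>\<^bsub>M1\<^esub> n1)),
      smult = (\<lambda>(a, b) (m0, m1).
        (a \<odot>\<^bsub>M0\<^esub> m0, (a \<odot>\<^bsub>M1\<^esub> m1 \<oplus>\<^bsub>M1\<^esub> b \<odot>\<^bsub>M1\<^esub> T m0) \<oplus>\<^bsub>M1\<^esub> \<phi> a m0))\<rparr>"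

type_synonym ('x, 'y, 'v, 'w) af_triple = "('x \<Rightarrow> 'v) \<times> ('x \<Rightarrow> 'w) \<times> ('y \<Rightarrow> 'w)"

fun af_morphism ::
    "'k ring \<Rightarrow> ('k, 'a) module \<Rightarrow> ('a, 'x, 'y) af_tuple \<Rightarrow> ('a, 'v, 'w) af_tuple \<Rightarrow>
      ('x, 'y, 'v, 'w) af_triple \<Rightarrow> bool" where
  "af_morphism K A (M0, M1, TM, \<phi>M) (N0, N1, TN, \<phi>N) (u0, u1, u2) \<longleftrightarrow>
     u0 \<in> mod_hom A M0 N0 \<and> u2 \<in> mod_hom A M1 N1 \<and>
     u1 \<in> mod_hom K (restrict_scalars A M0) (restrict_scalars A N1) \<and>
     (\<forall>m \<in> carrier M0. TN (u0 m) = u2 (TM m)) \<and>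
     (\<forall>a \<in> carrier A. \<forall>m \<in> carrier M0.
        u1 (a \<odot>\<^bsub>M0\<^esub> m) = (a \<odot>\<^bsub>N1\<^esub> u1 m \<ominus>\<^bsub>N1\<^esub> u2 (\<phi>M a m)) \<oplus>\<^bsub>N1\<^esub> \<phi>N a (u0 m))"

text \<open>The first argument is the target; its addition is needed.\<close>

fun af_map ::
    "('a, 'v, 'w) af_tuple \<Rightarrow> ('x, 'y, 'v, 'w) af_triple \<Rightarrow> 'x \<times> 'y \<Rightarrow> 'v \<times> 'w" where
  "af_map (N0, N1, TN, \<phi>N) (u0, u1, u2) (m0, m1) = (u0 m0, u1 m0 \<oplus>\<^bsub>N1\<^esub> u2 m1)"

definition af_minimal_projective_resolution ::
    "'k ring \<Rightarrow> ('k, 'a) module \<Rightarrow> ('a \<Rightarrow> 'a \<Rightarrow> 'a) \<Rightarrow> (nat \<Rightarrow> ('a, 'x, 'y) af_tuple) \<Rightarrow>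
      (nat \<Rightarrow> ('x, 'y, 'x, 'y) af_triple) \<Rightarrow> ('x, 'y, 'v, 'w) af_triple \<Rightarrow>
      ('a, 'v, 'w) af_tuple \<Rightarrow> bool" where
  "af_minimal_projective_resolution K A f P u u0 N \<longleftrightarrow>
     af_object K A f N \<and> (\<forall>i. af_object K A f (P i)) \<and>
     af_morphism K A (P 0) N u0 \<and> (\<forall>i. af_morphism K A (P (i + 1)) (P i) (u (i + 1))) \<and>
     minimal_projective_resolution K (af_alg A f) (\<lambda>i. af_module (P i))
       (\<lambda>i. af_map (P (i - 1)) (u i)) (af_map N u0) (af_module N)"

definition zero_module :: "('a, unit) module" where
  "zero_module =
     \<lparr>carrier = {()}, monoid.mult = (\<lambda>_ _. ()), one = (), ring.zero = (), ring.add = (\<lambda>_ _. ()),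
      smult = (\<lambda>_ _. ())\<rparr>"

definition zero_map :: "('a, 'y) module \<Rightarrow> 'x \<Rightarrow> 'y" where
  "zero_map Y = (\<lambda>_. \<zero>\<^bsub>Y\<^esub>)"

text \<open>An \<open>A\<close>-module \<open>M\<close> regarded as the \<open>A\<^sub>f\<close>-module \<open>(0, M, 0, 0)\<close>.\<close>

definition inflate :: "('a, 'm) module \<Rightarrow> ('a, unit, 'm) af_tuple" where
  "inflate M = (zero_module, M, zero_map M, (\<lambda>_. zero_map M))"

definition f_proj ::
    "('k, 'a) module \<Rightarrow> ('a \<Rightarrow> 'a \<Rightarrow> 'a) \<Rightarrow> (nat \<Rightarrow> 'a) \<Rightarrow> nat list \<Rightarrow> 'a \<Rightarrow> (nat \<Rightarrow> 'a) \<Rightarrow> (nat \<Rightarrow> 'a)"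
  where
  "f_proj A f e js a x = (\<lambda>r. if r < length js then f a (x r) \<otimes>\<^bsub>A\<^esub> e (js ! r) else \<zero>\<^bsub>A\<^esub>)"

definition hat ::
    "('k, 'a) module \<Rightarrow> ('a \<Rightarrow> 'a \<Rightarrow> 'a) \<Rightarrow> (nat \<Rightarrow> 'a) \<Rightarrow> nat list \<Rightarrow>
      ('a, nat \<Rightarrow> 'a, nat \<Rightarrow> 'a) af_tuple" where
  "hat A f e js = (proj_sum A e js, proj_sum A e js, (\<lambda>x. x), f_proj A f e js)"

text \<open>The map \<open>T\<^sub>\<delta> : Q \<rightarrow> Q'\<close>, \<open>[T\<^sub>\<delta>(x)] = f~([x] \<otimes> B) E'\<close>, where \<open>B\<close> is the matrix of \<open>\<delta> : Q \<rightarrow> Q'\<close>.\<close>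

definition T_map ::
    "('k, 'a) module \<Rightarrow> ('a \<Rightarrow> 'a \<Rightarrow> 'a) \<Rightarrow> (nat \<Rightarrow> 'a) \<Rightarrow> nat list \<Rightarrow> nat list \<Rightarrow>
      (nat \<Rightarrow> nat \<Rightarrow> 'a) \<Rightarrow> (nat \<Rightarrow> 'a) \<Rightarrow> (nat \<Rightarrow> 'a)" where
  "T_map A f e js js' B x =
     (\<lambda>j. if j < length js'
          then (\<Oplus>\<^bsub>A\<^esub> l \<in> {..<length js}. f (x l) (B l j)) \<otimes>\<^bsub>A\<^esub> e (js' ! j) else \<zero>\<^bsub>A\<^esub>)"

text \<open>The resolution has terms \<open>Q i = proj_sum A e (q i)\<close>, and \<open>B i\<close> is the matrix of \<open>\<delta> i\<close> for
  \<open>i \<ge> 1\<close>. The two summands in (ii) are images of linear maps, hence automatically subspaces.\<close>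

definition condition_star_B ::
    "('k, 'a) module \<Rightarrow> ('a \<Rightarrow> 'a \<Rightarrow> 'a) \<Rightarrow> (nat \<Rightarrow> 'a) \<Rightarrow> (nat \<Rightarrow> nat list) \<Rightarrow>
      (nat \<Rightarrow> nat \<Rightarrow> nat \<Rightarrow> 'a) \<Rightarrow> (nat \<Rightarrow> (nat \<Rightarrow> 'a) \<Rightarrow> (nat \<Rightarrow> 'a)) \<Rightarrow> ((nat \<Rightarrow> 'a) \<Rightarrow> 'm) \<Rightarrow> bool"
  where
  "condition_star_B A f e q B \<delta> \<delta>0 \<longleftrightarrow>
     (let Q = (\<lambda>i. proj_sum A e (q i));
          T = (\<lambda>i. T_map A f e (q i) (q (i - 1)) (B i));
          Ker = (\<lambda>i. a_kernel (Q i) (Q (i - 1)) (\<delta> i))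
      in \<forall>i.
        (if i = 0 then inj_on (\<lambda>x. \<delta>0 (T 1 x)) (Ker 1)
         else inj_on (\<lambda>x. \<delta> (2 * i) (T (2 * i + 1) x)) (Ker (2 * i + 1))) \<and>
        carrier (Q (2 * i)) =
          T (2 * i + 1) ` Ker (2 * i + 1) <+>\<^bsub>Q (2 * i)\<^esub>
            \<delta> (2 * i + 1) ` carrier (Q (2 * i + 1)) \<and>
        T (2 * i + 1) ` Ker (2 * i + 1) \<inter> \<delta> (2 * i + 1) ` carrier (Q (2 * i + 1))
          = {\<zero>\<^bsub>Q (2 * i)\<^esub>})"

end

theory Submission
  imports Defs
begin

text \<open>
  The underlying space of \<open>Q^ = (Q, Q, Id, f\<^sub>Q)\<close> is \<open>Q \<oplus> Q\<close>, and \<open>t\<close> acts on it by \<open>(x, y) \<mapsto> (0, x)\<close>. The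
  lifted differentials are \<open>(x, y) \<mapsto> (0, \<delta> x)\<close> in even degrees and the twisted maps
  \<open>(x, y) \<mapsto> (\<delta> x, T x + \<delta> y)\<close> in odd degrees. That the latter respect the action of \<open>A\<^sub>f\<close> is the cocycle
  identity for the triples \<open>(a, x\<^sub>l, b\<^bsub>lj\<^esub>)\<close>, summed over \<open>l\<close> (\<open>hat_morphism_odd\<close>).

  Exactness. An even differential has kernel \<open>Ker \<delta> \<times> Q\<close> and image \<open>0 \<times> Im \<delta>\<close>, so an odd one has to have
  image \<open>Im \<delta> \<times> Q'\<close> and kernel \<open>0 \<times> Ker \<delta>\<close>. For the image, changing \<open>x\<close> by \<open>k \<in> Ker \<delta>\<close> keeps \<open>\<delta> x\<close> and adds
  \<open>T k\<close> to the second component, and \<open>T(Ker \<delta>) + Im \<delta> = Q'\<close> (\<open>twisted_map_image\<close>). For the kernel,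
  \<open>\<delta> x = 0\<close> and \<open>T x + \<delta> y = 0\<close> put \<open>T x\<close> into \<open>T(Ker \<delta>) \<inter> Im \<delta> = 0\<close>, and \<open>T\<close> is injective on \<open>Ker \<delta>\<close>
  (\<open>twisted_map_kernel\<close>). The direct sum is part (ii) of the condition on the
  resolution, and the injectivity of \<open>T\<close> follows from part (i).

  Projectivity. Every idempotent \<open>e\<close> of \<open>A\<close> lifts to the idempotent \<open>e + (f(e, e) - 2 f(e, e) e) t\<close> of \<open>A\<^sub>f\<close>,
  and the lift of \<open>Ae\<close> is the left ideal that it generates. Written out, this gives a finite dual basis
  of \<open>Q^\<close>, and a module with a finite dual basis has the lifting property (\<open>projective_of_dual_basis\<close>,
  \<open>projective_hat\<close>).

  Minimality. The kernel of each lifted differential lies in \<open>Ker \<delta> \<times> Q\<close>. If \<open>L + (Ker \<delta> \<times> Q) = Q^\<close>, then the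
  first projection of \<open>L\<close> is all of \<open>Q\<close>, because \<open>Ker \<delta>\<close> is superfluous; multiplying by \<open>t\<close> shows that
  \<open>L\<close> contains \<open>0 \<times> Q\<close>, and hence \<open>L = Q^\<close> (\<open>superfluous_af_module\<close>).
\<close>

section \<open>Abelian groups, modules and homomorphisms\<close>

text \<open>Makes the method \<open>algebra\<close> normalise in the additive groups of modules, as \<open>ring_simprules\<close> does
  in rings.\<close>

lemmas (in abelian_group) abelian_group_simprules
  [algebra abelian_group "ring.zero G" "ring.add G" "a_inv G" "a_minus G"] =
  a_closed zero_closed a_inv_closed minus_closed
  a_assoc l_zero l_neg a_comm minus_eq
  r_zero r_neg r_neg2 r_neg1 minus_add minus_minus a_lcomm

text \<open>Sorting a sum need not bring \<open>x\<close> and \<open>\<ominus> x\<close> next to each other; these rules remove such a pair across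
  a few intermediate terms.\<close>

lemma (in abelian_group) a_cancel:
  assumes "x \<in> carrier G" "y \<in> carrier G"
  shows "x \<oplus> (y \<oplus> \<ominus> x) = y" and "\<ominus> x \<oplus> (y \<oplus> x) = y"
    and "z \<in> carrier G \<Longrightarrow> x \<oplus> (y \<oplus> (\<ominus> x \<oplus> z)) = y \<oplus> z"
    and "z \<in> carrier G \<Longrightarrow> \<ominus> x \<oplus> (y \<oplus> (x \<oplus> z)) = y \<oplus> z"
    and "z \<in> carrier G \<Longrightarrow> x \<oplus> (y \<oplus> (z \<oplus> \<ominus> x)) = y \<oplus> z"
    and "z \<in> carrier G \<Longrightarrow> \<ominus> x \<oplus> (y \<oplus> (z \<oplus> x)) = y \<oplus> z"
    and "\<lbrakk>z \<in> carrier G; w \<in> carrier G\<rbrakk> \<Longrightarrow> x \<oplus> (y \<oplus> (z \<oplus> (w \<oplus> \<ominus> x))) = y \<oplus> (z \<oplus> w)"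
  using assms by algebra+

text \<open>The shape of the cocycle identities for \<open>f\<close> and for the structure maps of \<open>A\<^sub>f\<close>-modules, solved for the
  term with a product in the first argument. That term is the useful one to eliminate: the
  verifications below meet it as \<open>f (a \<otimes> b) c\<close> or \<open>\<phi> (a \<otimes> b) m\<close>.\<close>

lemma (in abelian_group) solve_alternating:
  assumes "p \<in> carrier G" "x \<in> carrier G" "q \<in> carrier G" "r \<in> carrier G"
    and "((p \<ominus> x) \<oplus> q) \<ominus> r = \<zero>"
  shows "x = (p \<oplus> q) \<ominus> r"
proof -
  have "x = x \<oplus> (((p \<ominus> x) \<oplus> q) \<ominus> r)"
    using assms by simp
  also have "\<dots> = (p \<oplus> q) \<ominus> r"
    using assms(1-4) by algebra
  finally show ?thesis .
qed

text \<open>The shape that the cocycle identities take when their first two arguments are \<open>1\<close>.\<close>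

lemma (in abelian_group) eq_if_double_minus:
  assumes "x \<in> carrier G" "y \<in> carrier G" and "x = (x \<oplus> x) \<ominus> y"
  shows "x = y"
proof -
  have "x \<oplus> y = ((x \<oplus> x) \<ominus> y) \<oplus> y"
    using assms(3) by simp
  also have "\<dots> = x \<oplus> x"
    using assms(1,2) by (simp add: a_minus_def a_assoc l_neg)
  finally show ?thesis
    using assms(1,2) by simp
qed

lemma mod_homD:
  assumes "h \<in> mod_hom R W Y"
  shows "x \<in> carrier W \<Longrightarrow> h x \<in> carrier Y"
    and "\<lbrakk>x \<in> carrier W; y \<in> carrier W\<rbrakk> \<Longrightarrow> h (x \<oplus>\<^bsub>W\<^esub> y) = h x \<oplus>\<^bsub>Y\<^esub> h y"
    and "\<lbrakk>a \<in> carrier R; x \<in> carrier W\<rbrakk> \<Longrightarrow> h (a \<odot>\<^bsub>W\<^esub> x) = a \<odot>\<^bsub>Y\<^esub> h x"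
  using assms by (auto simp: mod_hom_def hom_def)

lemma mod_homI:
  assumes "\<And>x. x \<in> carrier W \<Longrightarrow> h x \<in> carrier Y"
    and "\<And>x y. \<lbrakk>x \<in> carrier W; y \<in> carrier W\<rbrakk> \<Longrightarrow> h (x \<oplus>\<^bsub>W\<^esub> y) = h x \<oplus>\<^bsub>Y\<^esub> h y"
    and "\<And>a x. \<lbrakk>a \<in> carrier R; x \<in> carrier W\<rbrakk> \<Longrightarrow> h (a \<odot>\<^bsub>W\<^esub> x) = a \<odot>\<^bsub>Y\<^esub> h x"
  shows "h \<in> mod_hom R W Y"
  using assms by (auto simp: mod_hom_def hom_def)

lemma additive_zero:
  assumes "abelian_group W" and "abelian_group Y"
    and "\<And>x. x \<in> carrier W \<Longrightarrow> h x \<in> carrier Y"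
    and "\<And>x y. \<lbrakk>x \<in> carrier W; y \<in> carrier W\<rbrakk> \<Longrightarrow> h (x \<oplus>\<^bsub>W\<^esub> y) = h x \<oplus>\<^bsub>Y\<^esub> h y"
  shows "h \<zero>\<^bsub>W\<^esub> = \<zero>\<^bsub>Y\<^esub>"
proof -
  interpret W: abelian_group W by fact
  interpret Y: abelian_group Y by fact
  show ?thesis using assms(3) assms(4)[of "\<zero>\<^bsub>W\<^esub>" "\<zero>\<^bsub>W\<^esub>"] by simp
qed

lemma additive_minus:
  assumes "abelian_group W" and "abelian_group Y"
    and "\<And>x. x \<in> carrier W \<Longrightarrow> h x \<in> carrier Y"
    and "\<And>x y. \<lbrakk>x \<in> carrier W; y \<in> carrier W\<rbrakk> \<Longrightarrow> h (x \<oplus>\<^bsub>W\<^esub> y) = h x \<oplus>\<^bsub>Y\<^esub> h y"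
    and "x \<in> carrier W"
  shows "h (\<ominus>\<^bsub>W\<^esub> x) = \<ominus>\<^bsub>Y\<^esub> h x"
proof -
  interpret W: abelian_group W by fact
  interpret Y: abelian_group Y by fact
  have "h (\<ominus>\<^bsub>W\<^esub> x) \<oplus>\<^bsub>Y\<^esub> h x = \<zero>\<^bsub>Y\<^esub>"
    using assms(4)[of "\<ominus>\<^bsub>W\<^esub> x" x] assms(5) additive_zero[OF assms(1-4)]
    by (simp add: W.l_neg)
  then show ?thesis
    by (metis W.a_inv_closed Y.minus_equality assms(3,5))
qed

lemma additive_finsum:
  assumes "abelian_group W" and "abelian_group Y"
    and "\<And>x. x \<in> carrier W \<Longrightarrow> h x \<in> carrier Y"
    and "\<And>x y. \<lbrakk>x \<in> carrier W; y \<in> carrier W\<rbrakk> \<Longrightarrow> h (x \<oplus>\<^bsub>W\<^esub> y) = h x \<oplus>\<^bsub>Y\<^esub> h y"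
    and "finite S" and "g \<in> S \<rightarrow> carrier W"
  shows "h (\<Oplus>\<^bsub>W\<^esub> s \<in> S. g s) = (\<Oplus>\<^bsub>Y\<^esub> s \<in> S. h (g s))"
proof -
  interpret W: abelian_group W by fact
  interpret Y: abelian_group Y by fact
  show ?thesis using assms(5,6)
  proof (induction S)
    case empty
    then show ?case using additive_zero[OF assms(1-4)] by simp
  next
    case (insert s S)
    then have "(\<Oplus>\<^bsub>W\<^esub> s \<in> S. g s) \<in> carrier W" by (auto intro: W.finsum_closed)
    then show ?case using insert assms(3,4)
      by (simp add: W.finsum_insert Y.finsum_insert Pi_def)
  qed
qed

context left_module
begin

lemma smult_l_null: "x \<in> carrier M \<Longrightarrow> \<zero> \<odot>\<^bsub>M\<^esub> x = \<zero>\<^bsub>M\<^esub>"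
  by (rule additive_zero[OF R.abelian_group_axioms M.abelian_group_axioms, where h = "\<lambda>a. a \<odot>\<^bsub>M\<^esub> x"])
    (simp_all add: smult_closed smult_l_distr)

lemma smult_r_null: "a \<in> carrier R \<Longrightarrow> a \<odot>\<^bsub>M\<^esub> \<zero>\<^bsub>M\<^esub> = \<zero>\<^bsub>M\<^esub>"
  by (rule additive_zero[OF M.abelian_group_axioms M.abelian_group_axioms, where h = "\<lambda>x. a \<odot>\<^bsub>M\<^esub> x"])
    (simp_all add: smult_closed smult_r_distr)

lemma smult_l_minus:
  "\<lbrakk>a \<in> carrier R; x \<in> carrier M\<rbrakk> \<Longrightarrow> (\<ominus> a) \<odot>\<^bsub>M\<^esub> x = \<ominus>\<^bsub>M\<^esub> (a \<odot>\<^bsub>M\<^esub> x)"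
  by (rule additive_minus[OF R.abelian_group_axioms M.abelian_group_axioms, where h = "\<lambda>a. a \<odot>\<^bsub>M\<^esub> x"])
    (simp_all add: smult_closed smult_l_distr)

lemma smult_r_minus:
  "\<lbrakk>a \<in> carrier R; x \<in> carrier M\<rbrakk> \<Longrightarrow> a \<odot>\<^bsub>M\<^esub> (\<ominus>\<^bsub>M\<^esub> x) = \<ominus>\<^bsub>M\<^esub> (a \<odot>\<^bsub>M\<^esub> x)"
  by (rule additive_minus[OF M.abelian_group_axioms M.abelian_group_axioms, where h = "\<lambda>x. a \<odot>\<^bsub>M\<^esub> x"])
    (simp_all add: smult_closed smult_r_distr)

lemma smult_r_finsum:
  "\<lbrakk>a \<in> carrier R; finite S; g \<in> S \<rightarrow> carrier M\<rbrakk> \<Longrightarrow>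
    a \<odot>\<^bsub>M\<^esub> (\<Oplus>\<^bsub>M\<^esub> s \<in> S. g s) = (\<Oplus>\<^bsub>M\<^esub> s \<in> S. a \<odot>\<^bsub>M\<^esub> g s)"
  by (rule additive_finsum[OF M.abelian_group_axioms M.abelian_group_axioms, where h = "\<lambda>x. a \<odot>\<^bsub>M\<^esub> x"])
    (simp_all add: smult_closed smult_r_distr)

lemma submoduleI:
  assumes "H \<subseteq> carrier M" and "\<zero>\<^bsub>M\<^esub> \<in> H"
    and "\<And>x y. \<lbrakk>x \<in> H; y \<in> H\<rbrakk> \<Longrightarrow> x \<oplus>\<^bsub>M\<^esub> y \<in> H"
    and "\<And>a x. \<lbrakk>a \<in> carrier R; x \<in> H\<rbrakk> \<Longrightarrow> a \<odot>\<^bsub>M\<^esub> x \<in> H"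
  shows "submodule H R M"
proof -
  have "\<ominus>\<^bsub>M\<^esub> x \<in> H" if "x \<in> H" for x
  proof -
    have "(\<ominus> \<one>) \<odot>\<^bsub>M\<^esub> x = \<ominus>\<^bsub>M\<^esub> x"
      using that assms(1) by (subst smult_l_minus) (auto simp: smult_one)
    then show ?thesis using assms(4)[OF _ that, of "\<ominus> \<one>"] by simp
  qed
  then have "subgroup H (add_monoid M)"
    using assms by (intro subgroup.intro) (auto simp: a_inv_def)
  then show ?thesis
    using assms(4) by (intro submodule.intro) (auto simp: submodule_axioms_def)
qed

end

lemma zero_mod_hom:
  assumes "left_module R Y"
  shows "zero_map Y \<in> mod_hom R W Y"
proof -
  interpret Y: left_module R Y by fact
  show ?thesis by (rule mod_homI) (simp_all add: zero_map_def Y.smult_r_null)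
qed

lemma a_kernel_carrier_update: "a_kernel W (Y\<lparr>carrier := C\<rparr>) h = a_kernel W Y h"
  by (simp add: a_kernel_def')

lemma mod_hom_onto_image:
  assumes "h \<in> mod_hom R W Y"
  shows "h \<in> mod_hom R W (Y\<lparr>carrier := h ` carrier W\<rparr>)"
  using mod_homD[OF assms] by (intro mod_homI) simp_all

lemma submodule_a_kernel:
  assumes "left_module R W" and "left_module R Y" and "h \<in> mod_hom R W Y"
  shows "submodule (a_kernel W Y h) R W"
proof -
  interpret W: left_module R W by fact
  interpret Y: left_module R Y by fact
  note h = mod_homD[OF assms(3)]
  have "h \<zero>\<^bsub>W\<^esub> = \<zero>\<^bsub>Y\<^esub>"
    using additive_zero[OF W.M.abelian_group_axioms Y.M.abelian_group_axioms] h by blast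
  then show ?thesis
    by (intro W.submoduleI) (auto simp: a_kernel_def' h W.smult_closed Y.smult_r_null)
qed

lemma submoduleD:
  assumes "submodule H R M"
  shows "H \<subseteq> carrier M" and "\<zero>\<^bsub>M\<^esub> \<in> H"
    and "\<lbrakk>x \<in> H; y \<in> H\<rbrakk> \<Longrightarrow> x \<oplus>\<^bsub>M\<^esub> y \<in> H"
    and "\<lbrakk>a \<in> carrier R; x \<in> H\<rbrakk> \<Longrightarrow> a \<odot>\<^bsub>M\<^esub> x \<in> H"
proof -
  interpret submodule H R M by fact
  show "H \<subseteq> carrier M" and "\<zero>\<^bsub>M\<^esub> \<in> H"
    and "\<lbrakk>x \<in> H; y \<in> H\<rbrakk> \<Longrightarrow> x \<oplus>\<^bsub>M\<^esub> y \<in> H"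
    and "\<lbrakk>a \<in> carrier R; x \<in> H\<rbrakk> \<Longrightarrow> a \<odot>\<^bsub>M\<^esub> x \<in> H"
    using subset one_closed m_closed smult_closed by auto
qed

section \<open>Finite dimension\<close>

text \<open>Spanning is used in the form that no proper subspace contains the set. In this form the union of
  spanning sets of the factors is seen to span a product without any regrouping of linear
  combinations.\<close>

lemma finite_dim_spanning_set:
  assumes "left_module K V" and "finite_dim K V"
  obtains S where "finite S" and "S \<subseteq> carrier V"
    and "\<And>U. \<lbrakk>submodule U K V; S \<subseteq> U\<rbrakk> \<Longrightarrow> U = carrier V"
proof -
  interpret left_module K V by fact
  obtain S where S: "S \<subseteq> carrier V" "finite S"
    and span: "\<forall>v \<in> carrier V. \<exists>c \<in> S \<rightarrow> carrier K. v = (\<Oplus>\<^bsub>V\<^esub> s \<in> S. c s \<odot>\<^bsub>V\<^esub> s)"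
    using assms(2) unfolding finite_dim_def by blast
  have "U = carrier V" if U: "submodule U K V" and SU: "S \<subseteq> U" for U
  proof
    note U' = submoduleD[OF U]
    show "U \<subseteq> carrier V" by (rule U'(1))
    show "carrier V \<subseteq> U"
    proof
      fix v assume "v \<in> carrier V"
      then obtain c where c: "c \<in> S \<rightarrow> carrier K" "v = (\<Oplus>\<^bsub>V\<^esub> s \<in> S. c s \<odot>\<^bsub>V\<^esub> s)"
        using span by blast
      have "(\<Oplus>\<^bsub>V\<^esub> s \<in> S'. c s \<odot>\<^bsub>V\<^esub> s) \<in> U" if "finite S'" "S' \<subseteq> S" for S'
        using that
      proof (induction S')
        case empty
        show ?case using U'(2) by simp
      next
        case (insert s S')
        then have "c s \<odot>\<^bsub>V\<^esub> s \<in> U" using c(1) SU U'(4) by blast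
        moreover have "(\<lambda>s. c s \<odot>\<^bsub>V\<^esub> s) \<in> S' \<rightarrow> carrier V"
          using insert.prems c(1) S(1) by (auto intro!: smult_closed)
        ultimately show ?case
          using insert U'(1,3) by (subst M.finsum_insert) auto
      qed
      then show "v \<in> U" using c(2) S(2) by simp
    qed
  qed
  then show thesis using that S by blast
qed

lemma finite_dimI:
  assumes "left_module K V" and S: "finite S" "S \<subseteq> carrier V"
    and gen: "\<And>U. \<lbrakk>submodule U K V; S \<subseteq> U\<rbrakk> \<Longrightarrow> carrier V \<subseteq> U"
  shows "finite_dim K V"
proof -
  interpret left_module K V by fact
  let ?comb = "\<lambda>c. \<Oplus>\<^bsub>V\<^esub> s \<in> S. c s \<odot>\<^bsub>V\<^esub> s"
  have cl: "(\<lambda>s. c s \<odot>\<^bsub>V\<^esub> s) \<in> S \<rightarrow> carrier V" if "c \<in> S \<rightarrow> carrier K" for c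
    using that S(2) by (auto intro!: smult_closed)
  have "submodule (?comb ` (S \<rightarrow> carrier K)) K V"
  proof (rule submoduleI)
    show "?comb ` (S \<rightarrow> carrier K) \<subseteq> carrier V"
      using cl by (auto intro!: M.finsum_closed)
    have "?comb (\<lambda>_. \<zero>\<^bsub>K\<^esub>) = (\<Oplus>\<^bsub>V\<^esub> s \<in> S. \<zero>\<^bsub>V\<^esub>)"
      using S(2) by (intro M.finsum_cong') (auto simp: smult_l_null)
    then show "\<zero>\<^bsub>V\<^esub> \<in> ?comb ` (S \<rightarrow> carrier K)"
      by (intro image_eqI[where x = "\<lambda>_. \<zero>\<^bsub>K\<^esub>"]) (auto simp: M.finsum_zero)
  next
    fix x y assume "x \<in> ?comb ` (S \<rightarrow> carrier K)" "y \<in> ?comb ` (S \<rightarrow> carrier K)"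
    then obtain c d where c: "c \<in> S \<rightarrow> carrier K" "x = ?comb c"
      and d: "d \<in> S \<rightarrow> carrier K" "y = ?comb d" by blast
    have "x \<oplus>\<^bsub>V\<^esub> y = (\<Oplus>\<^bsub>V\<^esub> s \<in> S. c s \<odot>\<^bsub>V\<^esub> s \<oplus>\<^bsub>V\<^esub> d s \<odot>\<^bsub>V\<^esub> s)"
      unfolding c(2) d(2) using cl c(1) d(1) by (subst M.finsum_addf) auto
    also have "\<dots> = ?comb (\<lambda>s. c s \<oplus>\<^bsub>K\<^esub> d s)"
      using c(1) d(1) S(2) 
      by (intro M.finsum_cong') (auto simp: Pi_iff subset_iff smult_l_distr intro!: smult_closed)
    finally show "x \<oplus>\<^bsub>V\<^esub> y \<in> ?comb ` (S \<rightarrow> carrier K)"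
      using c(1) d(1) by (intro image_eqI[where x = "\<lambda>s. c s \<oplus>\<^bsub>K\<^esub> d s"]) auto
  next
    fix a x assume a: "a \<in> carrier K" and "x \<in> ?comb ` (S \<rightarrow> carrier K)"
    then obtain c where c: "c \<in> S \<rightarrow> carrier K" "x = ?comb c" by blast
    have "a \<odot>\<^bsub>V\<^esub> x = (\<Oplus>\<^bsub>V\<^esub> s \<in> S. a \<odot>\<^bsub>V\<^esub> (c s \<odot>\<^bsub>V\<^esub> s))"
      unfolding c(2) using cl[OF c(1)] a S(1) by (subst smult_r_finsum) auto
    also have "\<dots> = ?comb (\<lambda>s. a \<otimes>\<^bsub>K\<^esub> c s)"
      using c(1) a S(2)
      by (intro M.finsum_cong') (auto simp: Pi_iff subset_iff smult_assoc1 intro!: smult_closed)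
    finally show "a \<odot>\<^bsub>V\<^esub> x \<in> ?comb ` (S \<rightarrow> carrier K)"
      using c(1) a by (intro image_eqI[where x = "\<lambda>s. a \<otimes>\<^bsub>K\<^esub> c s"]) auto
  qed
  moreover have "S \<subseteq> ?comb ` (S \<rightarrow> carrier K)"
  proof
    fix s assume s: "s \<in> S"
    let ?c = "\<lambda>s'. if s = s' then \<one>\<^bsub>K\<^esub> else \<zero>\<^bsub>K\<^esub>"
    have "?comb ?c = (\<Oplus>\<^bsub>V\<^esub> s' \<in> S. if s = s' then s' else \<zero>\<^bsub>V\<^esub>)"
      using S(2) by (intro M.finsum_cong') (auto simp: smult_l_null smult_one)
    also have "\<dots> = s" using s S by (subst M.finsum_singleton) auto
    finally show "s \<in> ?comb ` (S \<rightarrow> carrier K)"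
      by (intro image_eqI[where x = ?c]) auto
  qed
  ultimately show ?thesis
    unfolding finite_dim_def using S gen by (intro exI[of _ S]) blast
qed

section \<open>Dual bases\<close>

text \<open>Given a surjection \<open>g\<close> onto \<open>Y\<close> and \<open>h : P \<rightarrow> Y\<close>, choose preimages \<open>w\<^sub>r\<close> of the \<open>h(p\<^sub>r)\<close>. Since the
  coordinates \<open>\<psi>\<^sub>r\<close> are linear, \<open>x \<mapsto> \<Sum> \<psi>\<^sub>r(x) w\<^sub>r\<close> is a homomorphism, and it lifts \<open>h\<close> because
  \<open>x = \<Sum> \<psi>\<^sub>r(x) p\<^sub>r\<close>.\<close>

lemma projective_of_dual_basis:
  fixes K :: "'k ring" and R :: "('k, 'a) module" and P :: "('a, 'p) module" and m :: nat
  assumes fd: "fd_module K R P"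
    and p: "\<And>r. r < m \<Longrightarrow> p r \<in> carrier P"
    and \<psi>_closed: "\<And>r x. \<lbrakk>r < m; x \<in> carrier P\<rbrakk> \<Longrightarrow> \<psi> r x \<in> carrier R"
    and \<psi>_add: "\<And>r x y. \<lbrakk>r < m; x \<in> carrier P; y \<in> carrier P\<rbrakk> \<Longrightarrow>
      \<psi> r (x \<oplus>\<^bsub>P\<^esub> y) = \<psi> r x \<oplus>\<^bsub>R\<^esub> \<psi> r y"
    and \<psi>_smult: "\<And>r a x. \<lbrakk>r < m; a \<in> carrier R; x \<in> carrier P\<rbrakk> \<Longrightarrow>
      \<psi> r (a \<odot>\<^bsub>P\<^esub> x) = a \<otimes>\<^bsub>R\<^esub> \<psi> r x"
    and dual: "\<And>x. x \<in> carrier P \<Longrightarrow> x = (\<Oplus>\<^bsub>P\<^esub> r \<in> {..<m}. \<psi> r x \<odot>\<^bsub>P\<^esub> p r)"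
  shows "projective K R P"
  unfolding projective_def
proof (intro conjI allI impI)
  show "fd_module K R P" by (rule fd)
  fix W Y :: "('a, nat \<Rightarrow> 'k) module" and g h
  assume "fd_module K R W" "fd_module K R Y" and g: "g \<in> mod_hom R W Y"
    and surj: "g ` carrier W = carrier Y" and h: "h \<in> mod_hom R P Y"
  then interpret W: left_module R W + Y: left_module R Y + P: left_module R P
    using fd by (auto simp: fd_module_def)
  note g' = mod_homD[OF g] and h' = mod_homD[OF h]
  have "\<forall>r. \<exists>w. r < m \<longrightarrow> w \<in> carrier W \<and> g w = h (p r)"
    using surj p h'(1) by (metis imageE)
  then obtain w where w: "\<And>r. r < m \<Longrightarrow> w r \<in> carrier W" "\<And>r. r < m \<Longrightarrow> g (w r) = h (p r)"
    by metis
  let ?l = "\<lambda>x. \<Oplus>\<^bsub>W\<^esub> r \<in> {..<m}. \<psi> r x \<odot>\<^bsub>W\<^esub> w r"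
  have cl: "(\<lambda>r. \<psi> r x \<odot>\<^bsub>W\<^esub> w r) \<in> {..<m} \<rightarrow> carrier W" if "x \<in> carrier P" for x
    using that w(1) \<psi>_closed by (auto intro!: W.smult_closed)
  show "\<exists>l \<in> mod_hom R P W. \<forall>x \<in> carrier P. g (l x) = h x"
  proof (intro bexI ballI)
    show "?l \<in> mod_hom R P W"
    proof (rule mod_homI)
      fix x assume x: "x \<in> carrier P"
      show "?l x \<in> carrier W" using cl[OF x] by (rule W.M.finsum_closed)
      fix y assume y: "y \<in> carrier P"
      have "?l (x \<oplus>\<^bsub>P\<^esub> y) = (\<Oplus>\<^bsub>W\<^esub> r \<in> {..<m}. \<psi> r x \<odot>\<^bsub>W\<^esub> w r \<oplus>\<^bsub>W\<^esub> \<psi> r y \<odot>\<^bsub>W\<^esub> w r)"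
        using x y w(1) \<psi>_closed
        by (intro W.M.finsum_cong') (auto simp: \<psi>_add W.smult_l_distr intro!: W.smult_closed)
      then show "?l (x \<oplus>\<^bsub>P\<^esub> y) = ?l x \<oplus>\<^bsub>W\<^esub> ?l y"
        using W.M.finsum_addf[OF cl[OF x] cl[OF y]] by simp
    next
      fix a x assume a: "a \<in> carrier R" and x: "x \<in> carrier P"
      have "?l (a \<odot>\<^bsub>P\<^esub> x) = (\<Oplus>\<^bsub>W\<^esub> r \<in> {..<m}. a \<odot>\<^bsub>W\<^esub> (\<psi> r x \<odot>\<^bsub>W\<^esub> w r))"
        using x a w(1) \<psi>_closed
        by (intro W.M.finsum_cong') (auto simp: \<psi>_smult W.smult_assoc1 intro!: W.smult_closed)
      then show "?l (a \<odot>\<^bsub>P\<^esub> x) = a \<odot>\<^bsub>W\<^esub> ?l x"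
        using W.smult_r_finsum[OF a _ cl[OF x]] by simp
    qed
    fix x assume x: "x \<in> carrier P"
    have "g (?l x) = (\<Oplus>\<^bsub>Y\<^esub> r \<in> {..<m}. g (\<psi> r x \<odot>\<^bsub>W\<^esub> w r))"
      using cl[OF x] g'
      by (intro additive_finsum[OF W.M.abelian_group_axioms Y.M.abelian_group_axioms]) auto
    also have "\<dots> = (\<Oplus>\<^bsub>Y\<^esub> r \<in> {..<m}. h (\<psi> r x \<odot>\<^bsub>P\<^esub> p r))"
      using x p w \<psi>_closed g' h'
      by (intro Y.M.finsum_cong') (auto intro!: P.smult_closed W.smult_closed Y.smult_closed)
    also have "\<dots> = h (\<Oplus>\<^bsub>P\<^esub> r \<in> {..<m}. \<psi> r x \<odot>\<^bsub>P\<^esub> p r)"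
      using x p \<psi>_closed h'
      by (intro additive_finsum[OF P.M.abelian_group_axioms Y.M.abelian_group_axioms, symmetric])
        (auto intro!: P.smult_closed)
    finally show "g (?l x) = h x" using dual[OF x] by simp
  qed
qed

section \<open>The deformed algebra\<close>

locale deformed_algebra =
  fixes K :: "'k ring" and A :: "('k, 'a) module" (structure) and f :: "'a \<Rightarrow> 'a \<Rightarrow> 'a"
  assumes alg: "fd_algebra K A" and cocycle: "hochschild_2_cocycle K A f"
begin

sublocale A?: ring A
  using alg by (simp add: fd_algebra_def)

sublocale KA: module K A
  using alg by (simp add: fd_algebra_def)

lemma scal_mult:
  assumes "c \<in> carrier K" "a \<in> carrier A" "b \<in> carrier A"
  shows "(c \<odot> a) \<otimes> b = c \<odot> (a \<otimes> b)" and "a \<otimes> (c \<odot> b) = c \<odot> (a \<otimes> b)"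
  using alg assms by (auto simp: fd_algebra_def)

lemma scal_one_mult: "\<lbrakk>c \<in> carrier K; a \<in> carrier A\<rbrakk> \<Longrightarrow> (c \<odot> \<one>) \<otimes> a = c \<odot> a"
  by (simp add: scal_mult)

lemma f_closed: "\<lbrakk>a \<in> carrier A; b \<in> carrier A\<rbrakk> \<Longrightarrow> f a b \<in> carrier A"
  and f_add_r: "\<lbrakk>a \<in> carrier A; b \<in> carrier A; c \<in> carrier A\<rbrakk> \<Longrightarrow> f a (b \<oplus> c) = f a b \<oplus> f a c"
  and f_add_l: "\<lbrakk>a \<in> carrier A; b \<in> carrier A; c \<in> carrier A\<rbrakk> \<Longrightarrow> f (a \<oplus> b) c = f a c \<oplus> f b c"
  and f_scal_r: "\<lbrakk>k \<in> carrier K; a \<in> carrier A; b \<in> carrier A\<rbrakk> \<Longrightarrow> f a (k \<odot> b) = k \<odot> f a b"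
  and f_scal_l: "\<lbrakk>k \<in> carrier K; a \<in> carrier A; b \<in> carrier A\<rbrakk> \<Longrightarrow> f (k \<odot> a) b = k \<odot> f a b"
  using cocycle by (auto simp: hochschild_2_cocycle_def bilinear_map_def dest: mod_homD)

lemma f_zero_r: "a \<in> carrier A \<Longrightarrow> f a \<zero> = \<zero>"
  using additive_zero[OF A.abelian_group_axioms A.abelian_group_axioms, where h = "\<lambda>x. f a x"]
  by (simp add: f_closed f_add_r)

lemma f_mult_l:
  assumes "a \<in> carrier A" "b \<in> carrier A" "c \<in> carrier A"
  shows "f (a \<otimes> b) c = (a \<otimes> f b c \<oplus> f a (b \<otimes> c)) \<ominus> f a b \<otimes> c"
  using cocycle assms
  by (intro solve_alternating) (simp_all add: hochschild_2_cocycle_def f_closed)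

text \<open>The cocycle identity at \<open>(a, 1, 1)\<close> and at \<open>(1, 1, a)\<close>. They make \<open>1 - f(1, 1) t\<close> the
  unit of \<open>A\<^sub>f\<close>.\<close>

lemma f_one_r:
  assumes "a \<in> carrier A"
  shows "f a \<one> = a \<otimes> f \<one> \<one>"
proof -
  have "f a \<one> = (a \<otimes> f \<one> \<one> \<oplus> f a \<one>) \<ominus> f a \<one> \<otimes> \<one>"
    using f_mult_l[of a \<one> \<one>] assms by simp
  also have "\<dots> = a \<otimes> f \<one> \<one>"
    using assms by (simp add: f_closed a_minus_def a_assoc r_neg)
  finally show ?thesis .
qed

lemma f_one_l:
  assumes a: "a \<in> carrier A"
  shows "f \<one> a = f \<one> \<one> \<otimes> a"
proof (rule eq_if_double_minus)
  have "f \<one> a = f (\<one> \<otimes> \<one>) a" by simp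
  also have "\<dots> = (\<one> \<otimes> f \<one> a \<oplus> f \<one> (\<one> \<otimes> a)) \<ominus> f \<one> \<one> \<otimes> a"
    using a by (intro f_mult_l) simp_all
  also have "\<dots> = (f \<one> a \<oplus> f \<one> a) \<ominus> f \<one> \<one> \<otimes> a"
    using a by (simp add: f_closed)
  finally show "f \<one> a = (f \<one> a \<oplus> f \<one> a) \<ominus> f \<one> \<one> \<otimes> a" .
qed (use a in \<open>simp_all add: f_closed\<close>)

text \<open>Associativity is the cocycle identity for the first components.\<close>

lemma af_ring: "ring (af_alg A f)"
proof (rule ringI)
  show "abelian_group (af_alg A f)"
  proof (rule abelian_groupI)
    fix x assume "x \<in> carrier (af_alg A f)"
    then obtain a b where x: "x = (a, b)" "a \<in> carrier A" "b \<in> carrier A"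
      by (auto simp: af_alg_def)
    then show "\<exists>y \<in> carrier (af_alg A f). y \<oplus>\<^bsub>af_alg A f\<^esub> x = \<zero>\<^bsub>af_alg A f\<^esub>"
      by (intro bexI[of _ "(\<ominus> a, \<ominus> b)"]) (auto simp: af_alg_def l_neg)
  qed (auto simp: af_alg_def a_ac)
  show "monoid (af_alg A f)"
  proof (rule monoidI)
    fix x y z
    assume "x \<in> carrier (af_alg A f)" "y \<in> carrier (af_alg A f)" "z \<in> carrier (af_alg A f)"
    then obtain a0 a1 b0 b1 c0 c1 where x: "x = (a0, a1)" "y = (b0, b1)" "z = (c0, c1)"
      and cl: "a0 \<in> carrier A" "a1 \<in> carrier A" "b0 \<in> carrier A" "b1 \<in> carrier A"
        "c0 \<in> carrier A" "c1 \<in> carrier A"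
      by (auto simp: af_alg_def)
    have "(a0 \<otimes> b0 \<otimes> c1 \<oplus> (a0 \<otimes> b1 \<oplus> a1 \<otimes> b0 \<oplus> f a0 b0) \<otimes> c0) \<oplus> f (a0 \<otimes> b0) c0
        = (a0 \<otimes> (b0 \<otimes> c1 \<oplus> b1 \<otimes> c0 \<oplus> f b0 c0) \<oplus> a1 \<otimes> (b0 \<otimes> c0)) \<oplus> f a0 (b0 \<otimes> c0)"
      unfolding f_mult_l[OF cl(1,3,5)]
      using cl f_closed[OF cl(1,3)] f_closed[OF cl(3,5)] f_closed[OF cl(1) m_closed[OF cl(3,5)]]
      by algebra
    then show "x \<otimes>\<^bsub>af_alg A f\<^esub> y \<otimes>\<^bsub>af_alg A f\<^esub> z = x \<otimes>\<^bsub>af_alg A f\<^esub> (y \<otimes>\<^bsub>af_alg A f\<^esub> z)"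
      unfolding x using cl by (simp add: af_alg_def m_assoc)
  next
    fix x assume "x \<in> carrier (af_alg A f)"
    then obtain a b where x: "x = (a, b)" and cl: "a \<in> carrier A" "b \<in> carrier A"
      by (auto simp: af_alg_def)
    have "(b \<oplus> (\<ominus> f \<one> \<one>) \<otimes> a) \<oplus> f \<one> \<one> \<otimes> a = b"
      and "(a \<otimes> (\<ominus> f \<one> \<one>) \<oplus> b) \<oplus> a \<otimes> f \<one> \<one> = b"
      using cl f_closed[OF one_closed one_closed] by algebra+
    then show "\<one>\<^bsub>af_alg A f\<^esub> \<otimes>\<^bsub>af_alg A f\<^esub> x = x" and "x \<otimes>\<^bsub>af_alg A f\<^esub> \<one>\<^bsub>af_alg A f\<^esub> = x"
      unfolding x using cl f_one_l[of a] f_one_r[of a] by (simp_all add: af_alg_def)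
  qed (auto simp: af_alg_def f_closed)
next
  fix x y z
  assume "x \<in> carrier (af_alg A f)" "y \<in> carrier (af_alg A f)" "z \<in> carrier (af_alg A f)"
  then show "(x \<oplus>\<^bsub>af_alg A f\<^esub> y) \<otimes>\<^bsub>af_alg A f\<^esub> z
      = x \<otimes>\<^bsub>af_alg A f\<^esub> z \<oplus>\<^bsub>af_alg A f\<^esub> y \<otimes>\<^bsub>af_alg A f\<^esub> z"
    and "z \<otimes>\<^bsub>af_alg A f\<^esub> (x \<oplus>\<^bsub>af_alg A f\<^esub> y)
      = z \<otimes>\<^bsub>af_alg A f\<^esub> x \<oplus>\<^bsub>af_alg A f\<^esub> z \<otimes>\<^bsub>af_alg A f\<^esub> y"
    by (auto simp: af_alg_def f_add_l f_add_r f_closed l_distr r_distr a_ac)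
qed

lemma left_module_restrict_scalars:
  assumes "left_module A W"
  shows "left_module K (restrict_scalars A W)"
proof -
  interpret W: left_module A W by fact
  have ab: "abelian_group (restrict_scalars A W)"
    by (rule abelian_groupI)
      (auto simp: restrict_scalars_def W.M.a_ac intro: bexI[of _ "\<ominus>\<^bsub>W\<^esub> _"] W.M.l_neg)
  have "(c \<otimes>\<^bsub>K\<^esub> d) \<odot> \<one> = (c \<odot> \<one>) \<otimes> (d \<odot> \<one>)" if "c \<in> carrier K" "d \<in> carrier K" for c d
    using that scal_mult(1)[of c \<one> "d \<odot> \<one>"] by (simp add: KA.smult_assoc1)
  then show ?thesis
    using KA.R.ring_axioms ab
    by (intro left_module.intro left_module_axioms.intro)
      (auto simp: restrict_scalars_def W.smult_closed W.smult_l_distr W.smult_r_distr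
        W.smult_assoc1 W.smult_one KA.smult_l_distr)
qed

lemma mod_hom_restrict_scalars:
  assumes "h \<in> mod_hom A W Y"
  shows "h \<in> mod_hom K (restrict_scalars A W) (restrict_scalars A Y)"
  using mod_homD[OF assms] by (intro mod_homI) (simp_all add: restrict_scalars_def)

end

section \<open>Modules over the deformed algebra\<close>

locale deformed_module = deformed_algebra K A f
  for K :: "'k ring" and A :: "('k, 'a) module" (structure) and f :: "'a \<Rightarrow> 'a \<Rightarrow> 'a" +
  fixes M0 :: "('a, 'x) module" and M1 :: "('a, 'y) module" and T :: "'x \<Rightarrow> 'y"
    and \<phi> :: "'a \<Rightarrow> 'x \<Rightarrow> 'y"
  assumes obj: "af_object K A f (M0, M1, T, \<phi>)"
begin

sublocale M0: left_module A M0
  using obj by (simp add: fd_module_def)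

sublocale M1: left_module A M1
  using obj by (simp add: fd_module_def)

lemma T_mod_hom: "T \<in> mod_hom A M0 M1"
  using obj by simp

lemmas T_closed = mod_homD(1)[OF T_mod_hom]
  and T_add = mod_homD(2)[OF T_mod_hom]
  and T_smult = mod_homD(3)[OF T_mod_hom]

lemma \<phi>_bilinear: "bilinear_map K A (restrict_scalars A M0) (restrict_scalars A M1) \<phi>"
  using obj by simp

lemma \<phi>_mod_hom_r: "a \<in> carrier A \<Longrightarrow> \<phi> a \<in> mod_hom K (restrict_scalars A M0) (restrict_scalars A M1)"
  and \<phi>_mod_hom_l: "m \<in> carrier M0 \<Longrightarrow> (\<lambda>a. \<phi> a m) \<in> mod_hom K A (restrict_scalars A M1)"
  using \<phi>_bilinear by (simp_all add: bilinear_map_def restrict_scalars_def)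

lemma \<phi>_closed: "\<lbrakk>a \<in> carrier A; m \<in> carrier M0\<rbrakk> \<Longrightarrow> \<phi> a m \<in> carrier M1"
  and \<phi>_add_r: "\<lbrakk>a \<in> carrier A; m \<in> carrier M0; m' \<in> carrier M0\<rbrakk> \<Longrightarrow>
      \<phi> a (m \<oplus>\<^bsub>M0\<^esub> m') = \<phi> a m \<oplus>\<^bsub>M1\<^esub> \<phi> a m'"
  using mod_homD(1,2)[OF \<phi>_mod_hom_r] by (simp_all add: restrict_scalars_def)

lemma \<phi>_add_l: "\<lbrakk>a \<in> carrier A; b \<in> carrier A; m \<in> carrier M0\<rbrakk> \<Longrightarrow>
      \<phi> (a \<oplus> b) m = \<phi> a m \<oplus>\<^bsub>M1\<^esub> \<phi> b m"
  and \<phi>_scal_l: "\<lbrakk>k \<in> carrier K; a \<in> carrier A; m \<in> carrier M0\<rbrakk> \<Longrightarrow>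
      \<phi> (k \<odot> a) m = (k \<odot> \<one>) \<odot>\<^bsub>M1\<^esub> \<phi> a m"
  using mod_homD(2,3)[OF \<phi>_mod_hom_l] by (simp_all add: restrict_scalars_def)

lemma \<phi>_mult_l:
  assumes "a \<in> carrier A" "b \<in> carrier A" "m \<in> carrier M0"
  shows "\<phi> (a \<otimes> b) m = (a \<odot>\<^bsub>M1\<^esub> \<phi> b m \<oplus>\<^bsub>M1\<^esub> \<phi> a (b \<odot>\<^bsub>M0\<^esub> m)) \<ominus>\<^bsub>M1\<^esub> f a b \<odot>\<^bsub>M1\<^esub> T m"
  using obj assms
  by (intro M1.M.solve_alternating)
    (simp_all add: M1.smult_closed M0.smult_closed \<phi>_closed f_closed T_closed)

text \<open>The unit of \<open>A\<^sub>f\<close> has second component \<open>- f(1, 1)\<close>; its action through \<open>T\<close> cancels \<open>\<phi> \<one>\<close>.\<close>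

lemma \<phi>_one:
  assumes m: "m \<in> carrier M0"
  shows "\<phi> \<one> m = f \<one> \<one> \<odot>\<^bsub>M1\<^esub> T m"
proof (rule M1.M.eq_if_double_minus)
  have "\<phi> \<one> m = \<phi> (\<one> \<otimes> \<one>) m" by simp
  also have "\<dots> = (\<one> \<odot>\<^bsub>M1\<^esub> \<phi> \<one> m \<oplus>\<^bsub>M1\<^esub> \<phi> \<one> (\<one> \<odot>\<^bsub>M0\<^esub> m)) \<ominus>\<^bsub>M1\<^esub> f \<one> \<one> \<odot>\<^bsub>M1\<^esub> T m"
    using m by (intro \<phi>_mult_l) simp_all
  also have "\<dots> = (\<phi> \<one> m \<oplus>\<^bsub>M1\<^esub> \<phi> \<one> m) \<ominus>\<^bsub>M1\<^esub> f \<one> \<one> \<odot>\<^bsub>M1\<^esub> T m"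
    using m by (simp add: M0.smult_one M1.smult_one \<phi>_closed)
  finally show "\<phi> \<one> m = (\<phi> \<one> m \<oplus>\<^bsub>M1\<^esub> \<phi> \<one> m) \<ominus>\<^bsub>M1\<^esub> f \<one> \<one> \<odot>\<^bsub>M1\<^esub> T m" .
qed (use m in \<open>simp_all add: M1.smult_closed \<phi>_closed f_closed T_closed\<close>)

lemma \<phi>_zero: "m \<in> carrier M0 \<Longrightarrow> \<phi> \<zero> m = \<zero>\<^bsub>M1\<^esub>"
  using additive_zero[OF A.abelian_group_axioms M1.M.abelian_group_axioms, of "\<lambda>a. \<phi> a m"]
  by (simp add: \<phi>_closed \<phi>_add_l)

text \<open>Compatibility with products is the identity relating \<open>\<phi>\<close>, \<open>f\<close> and \<open>T\<close>.\<close>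

lemma left_module_af_module: "left_module (af_alg A f) (af_module (M0, M1, T, \<phi>))"
proof (intro left_module.intro left_module_axioms.intro af_ring)
  let ?W = "af_module (M0, M1, T, \<phi>)"
  show "abelian_group ?W"
  proof (rule abelian_groupI)
    fix x assume "x \<in> carrier ?W"
    then obtain m0 m1 where x: "x = (m0, m1)" "m0 \<in> carrier M0" "m1 \<in> carrier M1"
      by auto
    then show "\<exists>y \<in> carrier ?W. y \<oplus>\<^bsub>?W\<^esub> x = \<zero>\<^bsub>?W\<^esub>"
      by (intro bexI[of _ "(\<ominus>\<^bsub>M0\<^esub> m0, \<ominus>\<^bsub>M1\<^esub> m1)"]) (auto simp: M0.M.l_neg M1.M.l_neg)
  qed (auto simp: M0.M.a_ac M1.M.a_ac)
  note closed = M0.smult_closed M1.smult_closed T_closed \<phi>_closed f_closed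
  show "x \<odot>\<^bsub>?W\<^esub> u \<in> carrier ?W"
    if "x \<in> carrier (af_alg A f)" "u \<in> carrier ?W" for x u
    using that by (auto simp: af_alg_def closed)
  show "(x \<oplus>\<^bsub>af_alg A f\<^esub> y) \<odot>\<^bsub>?W\<^esub> u = x \<odot>\<^bsub>?W\<^esub> u \<oplus>\<^bsub>?W\<^esub> y \<odot>\<^bsub>?W\<^esub> u"
    if "x \<in> carrier (af_alg A f)" "y \<in> carrier (af_alg A f)" "u \<in> carrier ?W" for x y u
    using that
    by (auto simp: closed af_alg_def M0.smult_l_distr M1.smult_l_distr \<phi>_add_l M1.M.a_ac)
  show "x \<odot>\<^bsub>?W\<^esub> (u \<oplus>\<^bsub>?W\<^esub> v) = x \<odot>\<^bsub>?W\<^esub> u \<oplus>\<^bsub>?W\<^esub> x \<odot>\<^bsub>?W\<^esub> v"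
    if "x \<in> carrier (af_alg A f)" "u \<in> carrier ?W" "v \<in> carrier ?W" for x u v
    using that
    by (auto simp: closed af_alg_def M0.smult_r_distr M1.smult_r_distr T_add \<phi>_add_r M1.M.a_ac)
  show "(x \<otimes>\<^bsub>af_alg A f\<^esub> y) \<odot>\<^bsub>?W\<^esub> u = x \<odot>\<^bsub>?W\<^esub> (y \<odot>\<^bsub>?W\<^esub> u)"
    if "x \<in> carrier (af_alg A f)" "y \<in> carrier (af_alg A f)" "u \<in> carrier ?W" for x y u
    using that
    by (auto simp: closed af_alg_def M0.smult_assoc1 M1.smult_assoc1 M1.smult_l_distr
        M1.smult_r_distr T_smult \<phi>_mult_l M1.M.a_ac a_minus_def M1.M.r_neg1 M1.M.r_neg2
        M1.M.a_cancel)
  show "\<one>\<^bsub>af_alg A f\<^esub> \<odot>\<^bsub>?W\<^esub> u = u" if "u \<in> carrier ?W" for u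
    using that
    by (auto simp: closed af_alg_def M0.smult_one M1.smult_one M1.smult_l_minus \<phi>_one
        M1.M.a_assoc M1.M.l_neg)
qed

text \<open>The field acts on \<open>M\<^sub>0 \<oplus> M\<^sub>1\<close> through multiples of the unit of \<open>A\<^sub>f\<close>, which need not be \<open>(1, 0)\<close>. This
  action is nevertheless componentwise, so spanning sets of \<open>M\<^sub>0\<close> and \<open>M\<^sub>1\<close> together span \<open>M\<^sub>0 \<oplus> M\<^sub>1\<close>.\<close>

lemma fd_module_af_module: "fd_module K (af_alg A f) (af_module (M0, M1, T, \<phi>))"
  unfolding fd_module_def
proof
  let ?W = "af_module (M0, M1, T, \<phi>)"
  let ?V = "restrict_scalars (af_alg A f) ?W"
  let ?Vx = "restrict_scalars A M0" and ?Vy = "restrict_scalars A M1"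
  interpret W: left_module "af_alg A f" ?W by (rule left_module_af_module)
  show "left_module (af_alg A f) ?W" by (rule left_module_af_module)
  interpret V0: left_module K ?Vx
    by (rule left_module_restrict_scalars) (rule M0.left_module_axioms)
  interpret V1: left_module K ?Vy
    by (rule left_module_restrict_scalars) (rule M1.left_module_axioms)
  have smult: "k \<odot>\<^bsub>?V\<^esub> (m0, m1) = (k \<odot>\<^bsub>?Vx\<^esub> m0, k \<odot>\<^bsub>?Vy\<^esub> m1)"
    if "k \<in> carrier K" "m0 \<in> carrier M0" "m1 \<in> carrier M1" for k m0 m1
  proof -
    \<comment> \<open>the second component is \<open>k m\<^sub>1\<close> plus these two terms\<close>
    have "(k \<odot> (\<ominus> f \<one> \<one>)) \<odot>\<^bsub>M1\<^esub> T m0 \<oplus>\<^bsub>M1\<^esub> \<phi> (k \<odot> \<one>) m0 = \<zero>\<^bsub>M1\<^esub>"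
    proof -
      have "k \<odot> (\<ominus> f \<one> \<one>) = (k \<odot> \<one>) \<otimes> (\<ominus> f \<one> \<one>)"
        using that by (simp add: scal_mult f_closed)
      then show ?thesis
        using that by (simp add: \<phi>_scal_l \<phi>_one M1.smult_assoc1 f_closed T_closed
            M1.smult_l_minus M1.smult_r_minus M1.smult_closed M1.M.l_neg)
    qed
    then show ?thesis using that
      by (simp add: restrict_scalars_def af_alg_def M1.M.a_assoc M1.smult_closed f_closed T_closed
          \<phi>_closed)
  qed
  have add: "(m0, m1) \<oplus>\<^bsub>?V\<^esub> (n0, n1) = (m0 \<oplus>\<^bsub>?Vx\<^esub> n0, m1 \<oplus>\<^bsub>?Vy\<^esub> n1)" for m0 m1 n0 n1
    by (simp add: restrict_scalars_def)
  have car: "carrier ?V = carrier ?Vx \<times> carrier ?Vy" "\<zero>\<^bsub>?V\<^esub> = (\<zero>\<^bsub>?Vx\<^esub>, \<zero>\<^bsub>?Vy\<^esub>)"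
    and car01: "carrier ?Vx = carrier M0" "carrier ?Vy = carrier M1"
    by (auto simp: restrict_scalars_def)
  note af_module.simps [simp del]
  have V: "left_module K ?V"
  proof (intro left_module.intro left_module_axioms.intro KA.R.ring_axioms)
    show "abelian_group ?V"
    proof (rule abelian_groupI)
      fix x assume "x \<in> carrier ?V"
      then obtain m0 m1 where x: "x = (m0, m1)" "m0 \<in> carrier ?Vx" "m1 \<in> carrier ?Vy"
        by (auto simp: car)
      then show "\<exists>y \<in> carrier ?V. y \<oplus>\<^bsub>?V\<^esub> x = \<zero>\<^bsub>?V\<^esub>"
        by (intro bexI[of _ "(\<ominus>\<^bsub>?Vx\<^esub> m0, \<ominus>\<^bsub>?Vy\<^esub> m1)"])
          (auto simp: car add V0.M.l_neg V1.M.l_neg)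
    qed (auto simp: car add V0.M.a_ac V1.M.a_ac)
  qed (auto simp: car smult add car01[symmetric] V0.smult_closed V1.smult_closed V0.smult_l_distr
      V1.smult_l_distr V0.smult_r_distr V1.smult_r_distr V0.smult_assoc1 V1.smult_assoc1
      V0.smult_one V1.smult_one)
  obtain S0 where S0: "finite S0" "S0 \<subseteq> carrier ?Vx"
    "\<And>U. \<lbrakk>submodule U K ?Vx; S0 \<subseteq> U\<rbrakk> \<Longrightarrow> U = carrier ?Vx"
    using finite_dim_spanning_set[OF V0.left_module_axioms] obj by (auto simp: fd_module_def)
  obtain S1 where S1: "finite S1" "S1 \<subseteq> carrier ?Vy"
    "\<And>U. \<lbrakk>submodule U K ?Vy; S1 \<subseteq> U\<rbrakk> \<Longrightarrow> U = carrier ?Vy"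
    using finite_dim_spanning_set[OF V1.left_module_axioms] obj by (auto simp: fd_module_def)
  show "finite_dim K ?V"
  proof (rule finite_dimI[OF V, of "(\<lambda>s. (s, \<zero>\<^bsub>?Vy\<^esub>)) ` S0 \<union> (\<lambda>s. (\<zero>\<^bsub>?Vx\<^esub>, s)) ` S1"])
    fix U assume U: "submodule U K ?V"
      and SU: "(\<lambda>s. (s, \<zero>\<^bsub>?Vy\<^esub>)) ` S0 \<union> (\<lambda>s. (\<zero>\<^bsub>?Vx\<^esub>, s)) ` S1 \<subseteq> U"
    note U' = submoduleD[OF U]
    have "submodule {m \<in> carrier ?Vx. (m, \<zero>\<^bsub>?Vy\<^esub>) \<in> U} K ?Vx"
    proof (rule V0.submoduleI)
      fix c m assume "c \<in> carrier K" "m \<in> {m \<in> carrier ?Vx. (m, \<zero>\<^bsub>?Vy\<^esub>) \<in> U}"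
      then show "c \<odot>\<^bsub>?Vx\<^esub> m \<in> {m \<in> carrier ?Vx. (m, \<zero>\<^bsub>?Vy\<^esub>) \<in> U}"
        using U'(4)[of c "(m, \<zero>\<^bsub>?Vy\<^esub>)"] smult[of c m "\<zero>\<^bsub>?Vy\<^esub>"]
        by (auto simp: car01[symmetric] V0.smult_closed V1.smult_r_null)
    qed (use U'(2) U'(3)[of "(_, \<zero>\<^bsub>?Vy\<^esub>)" "(_, \<zero>\<^bsub>?Vy\<^esub>)"] in \<open>auto simp: car add\<close>)
    then have 0: "{m \<in> carrier ?Vx. (m, \<zero>\<^bsub>?Vy\<^esub>) \<in> U} = carrier ?Vx"
      using S0(2,3) SU by blast
    have "submodule {m \<in> carrier ?Vy. (\<zero>\<^bsub>?Vx\<^esub>, m) \<in> U} K ?Vy"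
    proof (rule V1.submoduleI)
      fix c m assume "c \<in> carrier K" "m \<in> {m \<in> carrier ?Vy. (\<zero>\<^bsub>?Vx\<^esub>, m) \<in> U}"
      then show "c \<odot>\<^bsub>?Vy\<^esub> m \<in> {m \<in> carrier ?Vy. (\<zero>\<^bsub>?Vx\<^esub>, m) \<in> U}"
        using U'(4)[of c "(\<zero>\<^bsub>?Vx\<^esub>, m)"] smult[of c "\<zero>\<^bsub>?Vx\<^esub>" m]
        by (auto simp: car01[symmetric] V1.smult_closed V0.smult_r_null)
    qed (use U'(2) U'(3)[of "(\<zero>\<^bsub>?Vx\<^esub>, _)" "(\<zero>\<^bsub>?Vx\<^esub>, _)"] in \<open>auto simp: car add\<close>)
    then have 1: "{m \<in> carrier ?Vy. (\<zero>\<^bsub>?Vx\<^esub>, m) \<in> U} = carrier ?Vy"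
      using S1(2,3) SU by blast
    show "carrier ?V \<subseteq> U"
    proof
      fix x assume "x \<in> carrier ?V"
      then obtain m0 m1 where x: "x = (m0, m1)" "m0 \<in> carrier ?Vx" "m1 \<in> carrier ?Vy"
        by (auto simp: car)
      then show "x \<in> U"
        using U'(3)[of "(m0, \<zero>\<^bsub>?Vy\<^esub>)" "(\<zero>\<^bsub>?Vx\<^esub>, m1)"] 0 1 by (auto simp: add)
    qed
  qed (use S0 S1 in \<open>auto simp: car\<close>)
qed

end

text \<open>Given that \<open>u\<^sub>0\<close> and \<open>u\<^sub>2\<close> are \<open>A\<close>-linear, two conditions remain of \<open>A\<^sub>f\<close>-linearity:
  \<open>T\<^sub>N u\<^sub>0 = u\<^sub>2 T\<^sub>M\<close> compares the terms with \<open>b\<close> in the action of \<open>a + bt\<close>, and the twisted linearity of \<open>u\<^sub>1\<close> compares those with \<open>a\<close>.\<close>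

lemma (in deformed_algebra) af_map_mod_hom:
  assumes M: "af_object K A f M" and N: "af_object K A f N"
    and u: "af_morphism K A M N u"
  shows "af_map N u \<in> mod_hom (af_alg A f) (af_module M) (af_module N)"
proof -
  obtain M0 M1 TM \<phi>M N0 N1 TN \<phi>N u0 u1 u2
    where MNu: "M = (M0, M1, TM, \<phi>M)" "N = (N0, N1, TN, \<phi>N)" "u = (u0, u1, u2)"
    by (metis prod.exhaust)
  interpret M: deformed_module K A f M0 M1 TM \<phi>M
    using M MNu by unfold_locales simp
  interpret N: deformed_module K A f N0 N1 TN \<phi>N
    using N MNu by unfold_locales simp
  have u: "u0 \<in> mod_hom A M0 N0" "u2 \<in> mod_hom A M1 N1"
    "u1 \<in> mod_hom K (restrict_scalars A M0) (restrict_scalars A N1)"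
    and Tu: "\<And>m. m \<in> carrier M0 \<Longrightarrow> TN (u0 m) = u2 (TM m)"
    and u1: "\<And>a m. \<lbrakk>a \<in> carrier A; m \<in> carrier M0\<rbrakk> \<Longrightarrow>
        u1 (a \<odot>\<^bsub>M0\<^esub> m) = (a \<odot>\<^bsub>N1\<^esub> u1 m \<ominus>\<^bsub>N1\<^esub> u2 (\<phi>M a m)) \<oplus>\<^bsub>N1\<^esub> \<phi>N a (u0 m)"
    using u MNu by auto
  have u1': "\<And>m. m \<in> carrier M0 \<Longrightarrow> u1 m \<in> carrier N1"
    "\<And>m m'. \<lbrakk>m \<in> carrier M0; m' \<in> carrier M0\<rbrakk> \<Longrightarrow> u1 (m \<oplus>\<^bsub>M0\<^esub> m') = u1 m \<oplus>\<^bsub>N1\<^esub> u1 m'"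
    using mod_homD(1,2)[OF u(3)] by (auto simp: restrict_scalars_def)
  note u' = mod_homD[OF u(1)] mod_homD[OF u(2)] u1'
  note closed = M.M0.smult_closed M.M1.smult_closed M.T_closed M.\<phi>_closed
    N.M0.smult_closed N.M1.smult_closed N.T_closed N.\<phi>_closed
  show ?thesis
    unfolding MNu
  proof (rule mod_homI)
    fix x assume "x \<in> carrier (af_module (M0, M1, TM, \<phi>M))"
    then obtain m0 m1 where x: "x = (m0, m1)" "m0 \<in> carrier M0" "m1 \<in> carrier M1" by auto
    show "af_map (N0, N1, TN, \<phi>N) (u0, u1, u2) x \<in> carrier (af_module (N0, N1, TN, \<phi>N))"
      using x u' by simp
    fix y assume "y \<in> carrier (af_module (M0, M1, TM, \<phi>M))"
    then obtain n0 n1 where y: "y = (n0, n1)" "n0 \<in> carrier M0" "n1 \<in> carrier M1" by auto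
    show "af_map (N0, N1, TN, \<phi>N) (u0, u1, u2) (x \<oplus>\<^bsub>af_module (M0, M1, TM, \<phi>M)\<^esub> y)
      = af_map (N0, N1, TN, \<phi>N) (u0, u1, u2) x \<oplus>\<^bsub>af_module (N0, N1, TN, \<phi>N)\<^esub>
        af_map (N0, N1, TN, \<phi>N) (u0, u1, u2) y"
      using x y u' by (simp add: N.M1.M.a_ac)
  next
    fix \<alpha> x assume "\<alpha> \<in> carrier (af_alg A f)" "x \<in> carrier (af_module (M0, M1, TM, \<phi>M))"
    then obtain a b m0 m1 where x: "\<alpha> = (a, b)" "a \<in> carrier A" "b \<in> carrier A"
      "x = (m0, m1)" "m0 \<in> carrier M0" "m1 \<in> carrier M1" by (auto simp: af_alg_def)
    show "af_map (N0, N1, TN, \<phi>N) (u0, u1, u2) (\<alpha> \<odot>\<^bsub>af_module (M0, M1, TM, \<phi>M)\<^esub> x)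
      = \<alpha> \<odot>\<^bsub>af_module (N0, N1, TN, \<phi>N)\<^esub> af_map (N0, N1, TN, \<phi>N) (u0, u1, u2) x"
      using x u' closed
      by (simp add: u1 Tu N.M1.smult_r_distr a_minus_def N.M1.M.a_ac
          N.M1.M.r_neg1 N.M1.M.r_neg2 N.M1.M.a_cancel)
  qed
qed

section \<open>Lifting projective modules\<close>

locale deformed_algebra_with_idempotents = deformed_algebra K A f
  for K :: "'k ring" and A :: "('k, 'a) module" (structure) and f :: "'a \<Rightarrow> 'a \<Rightarrow> 'a" +
  fixes e :: "nat \<Rightarrow> 'a" and I :: "nat set"
  assumes idem: "i \<in> I \<Longrightarrow> idempotent_elt A (e i)"
begin

lemma e_closed: "i \<in> I \<Longrightarrow> e i \<in> carrier A"
  and e_idem: "i \<in> I \<Longrightarrow> e i \<otimes> e i = e i"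
  using idem by (auto simp: idempotent_elt_def)

lemma carrier_cyclic_left:
  "i \<in> I \<Longrightarrow> a \<in> carrier (cyclic_left A (e i)) \<longleftrightarrow> a \<in> carrier A \<and> a \<otimes> e i = a"
  by (auto simp: cyclic_left_def m_assoc e_closed e_idem intro: rev_image_eqI)

lemma proj_sumI:
  assumes "set js \<subseteq> I"
    and "\<And>r. r < length js \<Longrightarrow> x r \<in> carrier A"
    and "\<And>r. r < length js \<Longrightarrow> x r \<otimes> e (js ! r) = x r"
    and "\<And>r. r \<ge> length js \<Longrightarrow> x r = \<zero>"
  shows "x \<in> carrier (proj_sum A e js)"
  using assms carrier_cyclic_left by (auto simp: proj_sum_def subset_iff)

lemma proj_sumD:
  assumes "set js \<subseteq> I" and "x \<in> carrier (proj_sum A e js)"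
  shows "x r \<in> carrier A"
    and "r < length js \<Longrightarrow> x r \<otimes> e (js ! r) = x r"
    and "r \<ge> length js \<Longrightarrow> x r = \<zero>"
proof -
  have *: "js ! r \<in> I" if "r < length js"
    using that assms(1) nth_mem by blast
  show "r < length js \<Longrightarrow> x r \<otimes> e (js ! r) = x r" and "r \<ge> length js \<Longrightarrow> x r = \<zero>"
    using assms(2) carrier_cyclic_left[OF *] by (auto simp: proj_sum_def)
  show "x r \<in> carrier A"
    using assms(2) carrier_cyclic_left[OF *] by (cases "r < length js") (auto simp: proj_sum_def)
qed

lemma proj_sum_ops:
  "(x \<oplus>\<^bsub>proj_sum A e js\<^esub> y) r = x r \<oplus> y r"
  "(a \<odot>\<^bsub>proj_sum A e js\<^esub> x) r = a \<otimes> x r"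
  "\<zero>\<^bsub>proj_sum A e js\<^esub> = (\<lambda>_. \<zero>)"
  by (simp_all add: proj_sum_def)

lemma proj_sum_minus:
  assumes "set js \<subseteq> I" and "left_module A (proj_sum A e js)"
    and "x \<in> carrier (proj_sum A e js)" and "y \<in> carrier (proj_sum A e js)"
  shows "(x \<ominus>\<^bsub>proj_sum A e js\<^esub> y) r = x r \<ominus> y r"
proof -
  interpret Q: left_module A "proj_sum A e js" by fact
  have "(\<ominus>\<^bsub>proj_sum A e js\<^esub> y) r = \<ominus> y r"
    using assms proj_sumD(1)[OF assms(1)]
    by (intro additive_minus[OF Q.M.abelian_group_axioms A.abelian_group_axioms, where h = "\<lambda>x. x r"])
      (auto simp: proj_sum_ops)
  then show ?thesis by (simp add: a_minus_def proj_sum_ops)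
qed

lemma f_proj_closed:
  assumes "set js \<subseteq> I" and "a \<in> carrier A" and "x \<in> carrier (proj_sum A e js)"
  shows "f_proj A f e js a x \<in> carrier (proj_sum A e js)"
proof (rule proj_sumI[OF assms(1)])
  fix r assume "r < length js"
  then have "js ! r \<in> I" using assms(1) nth_mem by blast
  then show "f_proj A f e js a x r \<in> carrier A"
    and "f_proj A f e js a x r \<otimes> e (js ! r) = f_proj A f e js a x r"
    using assms(2) proj_sumD(1)[OF assms(1,3)]
    by (auto simp: f_proj_def f_closed e_closed e_idem m_assoc)
qed (simp add: f_proj_def)

text \<open>On the component \<open>Ae\<close> the required identity is the cocycle identity multiplied by \<open>e\<close> from the right;
  the term \<open>f(a, b) m\<close> is unchanged by this because \<open>m e = m\<close>.\<close>

lemma hat_object: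
  assumes js: "set js \<subseteq> I" and fd: "fd_module K A (proj_sum A e js)"
  shows "af_object K A f (hat A f e js)"
proof -
  let ?Q = "proj_sum A e js"
  have Q: "left_module A ?Q" using fd by (simp add: fd_module_def)
  interpret Q: left_module A ?Q by (rule Q)
  note D = proj_sumD[OF js]
  have eI: "e (js ! r) \<in> carrier A" if "r < length js" for r
    using that js e_closed nth_mem by blast
  have scal: "(c \<odot>\<^bsub>restrict_scalars A ?Q\<^esub> x) r = c \<odot> x r"
    if "c \<in> carrier K" "x \<in> carrier ?Q" for c x r
    using that D(1) by (simp add: restrict_scalars_def proj_sum_ops scal_one_mult)
  have add: "(x \<oplus>\<^bsub>restrict_scalars A ?Q\<^esub> y) r = x r \<oplus> y r" for x y r
    by (simp add: restrict_scalars_def proj_sum_ops)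
  have car: "carrier (restrict_scalars A ?Q) = carrier ?Q"
    by (simp add: restrict_scalars_def)
  have "bilinear_map K A (restrict_scalars A ?Q) (restrict_scalars A ?Q) (f_proj A f e js)"
    unfolding bilinear_map_def
  proof (intro conjI ballI)
    fix a assume a: "a \<in> carrier A"
    show "f_proj A f e js a \<in> mod_hom K (restrict_scalars A ?Q) (restrict_scalars A ?Q)"
    proof (rule mod_homI)
      fix x y c assume x: "x \<in> carrier (restrict_scalars A ?Q)"
      then show "f_proj A f e js a x \<in> carrier (restrict_scalars A ?Q)"
        using a js by (simp add: car f_proj_closed)
      then show "f_proj A f e js a (c \<odot>\<^bsub>restrict_scalars A ?Q\<^esub> x)
          = c \<odot>\<^bsub>restrict_scalars A ?Q\<^esub> f_proj A f e js a x" if "c \<in> carrier K"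
        using x a that D(1) eI
        by (intro ext) (auto simp: car scal, auto simp: f_proj_def scal f_scal_r f_closed scal_mult)
      assume y: "y \<in> carrier (restrict_scalars A ?Q)"
      show "f_proj A f e js a (x \<oplus>\<^bsub>restrict_scalars A ?Q\<^esub> y)
          = f_proj A f e js a x \<oplus>\<^bsub>restrict_scalars A ?Q\<^esub> f_proj A f e js a y"
        using x y a D(1) eI
        by (intro ext) (auto simp: car add f_proj_def f_add_r f_closed l_distr)
    qed
  next
    fix x assume x: "x \<in> carrier (restrict_scalars A ?Q)"
    show "(\<lambda>a. f_proj A f e js a x) \<in> mod_hom K A (restrict_scalars A ?Q)"
    proof (rule mod_homI)
      fix a b c assume a: "a \<in> carrier A"
      then show "f_proj A f e js a x \<in> carrier (restrict_scalars A ?Q)"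
        using x js by (simp add: car f_proj_closed)
      then show "f_proj A f e js (c \<odot> a) x = c \<odot>\<^bsub>restrict_scalars A ?Q\<^esub> f_proj A f e js a x"
        if "c \<in> carrier K"
        using x a that D(1) eI
        by (intro ext) (auto simp: car scal, auto simp: f_proj_def scal f_scal_l f_closed scal_mult)
      assume b: "b \<in> carrier A"
      show "f_proj A f e js (a \<oplus> b) x
          = f_proj A f e js a x \<oplus>\<^bsub>restrict_scalars A ?Q\<^esub> f_proj A f e js b x"
        using x b a D(1) eI
        by (intro ext) (auto simp: car add f_proj_def f_add_l f_closed l_distr)
    qed
  qed
  moreover have "((a \<odot>\<^bsub>?Q\<^esub> f_proj A f e js b m \<ominus>\<^bsub>?Q\<^esub> f_proj A f e js (a \<otimes> b) m) \<oplus>\<^bsub>?Q\<^esub>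
      f_proj A f e js a (b \<odot>\<^bsub>?Q\<^esub> m)) \<ominus>\<^bsub>?Q\<^esub> (f a b \<odot>\<^bsub>?Q\<^esub> m) = \<zero>\<^bsub>?Q\<^esub>" (is "?L = _")
    if ab: "a \<in> carrier A" "b \<in> carrier A" and m: "m \<in> carrier ?Q" for a b m
  proof
    fix r
    have cl: "a \<odot>\<^bsub>?Q\<^esub> f_proj A f e js b m \<in> carrier ?Q" "f_proj A f e js (a \<otimes> b) m \<in> carrier ?Q"
      "f_proj A f e js a (b \<odot>\<^bsub>?Q\<^esub> m) \<in> carrier ?Q" "f a b \<odot>\<^bsub>?Q\<^esub> m \<in> carrier ?Q"
      using ab m js by (auto simp: Q.smult_closed f_proj_closed f_closed)
    have L: "?L r = ((a \<otimes> f_proj A f e js b m r \<ominus> f_proj A f e js (a \<otimes> b) m r) \<oplus>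
      f_proj A f e js a (b \<odot>\<^bsub>?Q\<^esub> m) r) \<ominus> (f a b \<otimes> m r)"
      using cl by (simp add: proj_sum_minus[OF js Q] proj_sum_ops)
    show "?L r = \<zero>\<^bsub>?Q\<^esub> r"
    proof (cases "r < length js")
      case True
      let ?u = "e (js ! r)"
      have c: "f b (m r) \<in> carrier A" "f (a \<otimes> b) (m r) \<in> carrier A" "f a (b \<otimes> m r) \<in> carrier A"
        "f a b \<in> carrier A" "m r \<in> carrier A" "?u \<in> carrier A" "f a b \<otimes> m r \<in> carrier A"
        using ab m D(1) eI[OF True] by (auto simp: f_closed)
      have "?L r = (((a \<otimes> f b (m r) \<ominus> f (a \<otimes> b) (m r)) \<oplus> f a (b \<otimes> m r)) \<ominus> f a b \<otimes> m r) \<otimes> ?u"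
        unfolding L using True ab c D(2)[OF m True]
        by (simp add: f_proj_def proj_sum_ops a_minus_def l_distr l_minus m_assoc)
      moreover have "((a \<otimes> f b (m r) \<ominus> f (a \<otimes> b) (m r)) \<oplus> f a (b \<otimes> m r)) \<ominus> f a b \<otimes> m r = \<zero>"
        using cocycle ab c(5) by (simp add: hochschild_2_cocycle_def)
      ultimately show ?thesis using c(6) by (simp add: proj_sum_ops)
    next
      case False
      then show ?thesis
        unfolding L using D(3)[OF m] ab by (simp add: f_proj_def proj_sum_ops f_closed a_minus_def)
    qed
  qed
  moreover have "(\<lambda>x. x) \<in> mod_hom A ?Q ?Q" by (auto simp: mod_hom_def hom_def)
  ultimately show ?thesis using fd by (simp add: hat_def)
qed

definition hat_generator :: "nat list \<Rightarrow> nat \<Rightarrow> (nat \<Rightarrow> 'a) \<times> (nat \<Rightarrow> 'a)" where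
  "hat_generator js r = ((\<lambda>k. if k = r then e (js ! r) else \<zero>), (\<lambda>_. \<zero>))"

text \<open>For a single summand \<open>Ae\<close>, let \<open>p = (e, 0)\<close>, which is \<open>hat_generator\<close>, and let
  \<open>\<epsilon> = e + (f(e, e) - 2 f(e, e) e) t\<close> be the lifted idempotent of \<open>A\<^sub>f\<close>. Then \<open>\<epsilon> p = p\<close>, and
  \<open>c \<mapsto> c p\<close> is an isomorphism from \<open>A\<^sub>f \<epsilon>\<close> onto the lift of \<open>Ae\<close>. The formula is its inverse.\<close>

definition hat_coordinate :: "nat list \<Rightarrow> nat \<Rightarrow> (nat \<Rightarrow> 'a) \<times> (nat \<Rightarrow> 'a) \<Rightarrow> 'a \<times> 'a" where
  "hat_coordinate js r = (\<lambda>(x, y). let u = e (js ! r); v = f (x r) u in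
     (x r, (y r \<oplus> v) \<ominus> (v \<otimes> u \<oplus> v \<otimes> u)))"

text \<open>The elements \<open>hat_generator js r\<close> and the maps \<open>hat_coordinate js r\<close> form a dual basis. Linearity of
  the coordinates comes from the cocycle identity at \<open>(a, x, e)\<close> with \<open>x e = x\<close>: it reads
  \<open>f(a x, e) = a f(x, e) + f(a, x) - f(a, x) e\<close>, and multiplied by \<open>e\<close> from the right it becomes
  \<open>f(a x, e) e = a f(x, e) e\<close>.\<close>

lemma projective_hat:
  assumes js: "set js \<subseteq> I" and fd: "fd_module K A (proj_sum A e js)"
  shows "projective K (af_alg A f) (af_module (hat A f e js))"
proof -
  let ?Q = "proj_sum A e js" and ?P = "af_module (hat A f e js)" and ?m = "length js"
  interpret Q: left_module A ?Q using fd by (simp add: fd_module_def)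
  interpret H: deformed_module K A f ?Q ?Q "\<lambda>x. x" "f_proj A f e js"
    using hat_object[OF js fd] by unfold_locales (simp add: hat_def)
  have fdP: "fd_module K (af_alg A f) ?P"
    using H.fd_module_af_module by (simp add: hat_def)
  interpret P: left_module "af_alg A f" ?P using fdP by (simp add: fd_module_def)
  note D = proj_sumD[OF js]
  have eI: "e (js ! r) \<in> carrier A" "e (js ! r) \<otimes> e (js ! r) = e (js ! r)" if "r < ?m" for r
    using that js e_closed e_idem nth_mem by blast+
  have car: "carrier ?P = carrier ?Q \<times> carrier ?Q" by (simp add: hat_def)
  have gen: "hat_generator js r \<in> carrier ?P" if "r < ?m" for r
    using that eI js by (auto simp: car hat_generator_def intro!: proj_sumI)
  show ?thesis
  proof (rule projective_of_dual_basis[OF fdP gen])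
    fix r x assume r: "r < ?m" and "x \<in> carrier ?P"
    then obtain x0 x1 where x: "x = (x0, x1)" "x0 \<in> carrier ?Q" "x1 \<in> carrier ?Q"
      by (auto simp: car)
    let ?u = "e (js ! r)"
    let ?v = "f (x0 r) ?u"
    have cx: "x0 r \<in> carrier A" "x1 r \<in> carrier A" "?v \<in> carrier A" "?u \<in> carrier A"
      using x D(1) eI r by (auto simp: f_closed)
    show "hat_coordinate js r x \<in> carrier (af_alg A f)"
      using cx by (simp add: x hat_coordinate_def Let_def af_alg_def)
    fix y assume "y \<in> carrier ?P"
    then obtain y0 y1 where y: "y = (y0, y1)" "y0 \<in> carrier ?Q" "y1 \<in> carrier ?Q"
      by (auto simp: car)
    have cy: "y0 r \<in> carrier A" "y1 r \<in> carrier A" "f (y0 r) ?u \<in> carrier A"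
      using y D(1) eI r by (auto simp: f_closed)
    have "((x1 r \<oplus> y1 r) \<oplus> (?v \<oplus> f (y0 r) ?u)) \<ominus> ((?v \<oplus> f (y0 r) ?u) \<otimes> ?u \<oplus> (?v \<oplus> f (y0 r) ?u) \<otimes> ?u)
      = ((x1 r \<oplus> ?v) \<ominus> (?v \<otimes> ?u \<oplus> ?v \<otimes> ?u)) \<oplus>
        ((y1 r \<oplus> f (y0 r) ?u) \<ominus> (f (y0 r) ?u \<otimes> ?u \<oplus> f (y0 r) ?u \<otimes> ?u))"
      using cx cy by algebra
    then show "hat_coordinate js r (x \<oplus>\<^bsub>?P\<^esub> y)
        = hat_coordinate js r x \<oplus>\<^bsub>af_alg A f\<^esub> hat_coordinate js r y"
      using cx cy
      by (simp add: x y hat_coordinate_def Let_def af_alg_def hat_def proj_sum_ops f_add_l)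
  next
    fix r \<alpha> x assume r: "r < ?m" and "\<alpha> \<in> carrier (af_alg A f)" and "x \<in> carrier ?P"
    then obtain a b x0 x1 where x: "x = (x0, x1)" "x0 \<in> carrier ?Q" "x1 \<in> carrier ?Q"
      and \<alpha>: "\<alpha> = (a, b)" "a \<in> carrier A" "b \<in> carrier A"
      by (auto simp: car af_alg_def)
    let ?u = "e (js ! r)"
    let ?v = "f (x0 r) ?u" and ?w = "f a (x0 r)"
    have cx: "x0 r \<in> carrier A" "x1 r \<in> carrier A" "?v \<in> carrier A" "?u \<in> carrier A" "?w \<in> carrier A"
      using x \<alpha> D(1) eI r by (auto simp: f_closed)
    have xu: "x0 r \<otimes> ?u = x0 r" using D(2) x r by blast
    have uu: "?u \<otimes> ?u = ?u" using eI r by blast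
    have fu: "f (a \<otimes> x0 r) ?u = (a \<otimes> ?v \<oplus> ?w) \<ominus> ?w \<otimes> ?u"
      using f_mult_l[of a "x0 r" ?u] \<alpha> cx xu by simp
    have fuu: "f (a \<otimes> x0 r) ?u \<otimes> ?u = a \<otimes> (?v \<otimes> ?u)"
      unfolding fu using \<alpha> cx uu
      by (simp add: a_minus_def l_distr l_minus m_assoc r_neg a_assoc)
    have "((a \<otimes> x1 r \<oplus> b \<otimes> x0 r \<oplus> ?w \<otimes> ?u) \<oplus> ((a \<otimes> ?v \<oplus> ?w) \<ominus> ?w \<otimes> ?u))
          \<ominus> (a \<otimes> (?v \<otimes> ?u) \<oplus> a \<otimes> (?v \<otimes> ?u))
        = (a \<otimes> ((x1 r \<oplus> ?v) \<ominus> (?v \<otimes> ?u \<oplus> ?v \<otimes> ?u)) \<oplus> b \<otimes> x0 r) \<oplus> ?w"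
      using cx \<alpha>(2,3) by algebra
    then show "hat_coordinate js r (\<alpha> \<odot>\<^bsub>?P\<^esub> x) = \<alpha> \<otimes>\<^bsub>af_alg A f\<^esub> hat_coordinate js r x"
      using cx \<alpha> r fuu fu
      by (simp add: x \<alpha> hat_coordinate_def Let_def af_alg_def hat_def proj_sum_ops f_proj_def)
  next
    fix x assume "x \<in> carrier ?P"
    then obtain x0 x1 where x: "x = (x0, x1)" "x0 \<in> carrier ?Q" "x1 \<in> carrier ?Q"
      by (auto simp: car)
    let ?g = "\<lambda>r. hat_coordinate js r x \<odot>\<^bsub>?P\<^esub> hat_generator js r"
    have g: "?g r = ((\<lambda>k. if k = r then x0 r else \<zero>), (\<lambda>k. if k = r then x1 r else \<zero>))"
      if r: "r < ?m" for r
    proof -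
      let ?u = "e (js ! r)"
      let ?v = "f (x0 r) ?u"
      have cx: "x0 r \<in> carrier A" "x1 r \<in> carrier A" "?v \<in> carrier A" "?u \<in> carrier A"
        using x D(1) eI r by (auto simp: f_closed)
      have xu: "x0 r \<otimes> ?u = x0 r" "x1 r \<otimes> ?u = x1 r" using D(2) x r by blast+
      have uu: "?u \<otimes> ?u = ?u" using eI r by blast
      have "((x1 r \<oplus> ?v) \<ominus> (?v \<otimes> ?u \<oplus> ?v \<otimes> ?u)) \<otimes> ?u \<oplus> ?v \<otimes> ?u
          = (x1 r \<otimes> ?u \<oplus> ?v \<otimes> ?u \<oplus> ?v \<otimes> ?u) \<ominus> (?v \<otimes> (?u \<otimes> ?u) \<oplus> ?v \<otimes> (?u \<otimes> ?u))"
        using cx by algebra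
      also have "\<dots> = x1 r"
        unfolding uu xu using cx m_closed[OF cx(3,4)] by algebra
      finally show ?thesis
        using cx xu r eI
        by (auto simp: x hat_coordinate_def hat_generator_def Let_def hat_def proj_sum_def f_proj_def
            f_zero_r fun_eq_iff)
    qed
    have gc: "?g \<in> {..<?m} \<rightarrow> carrier ?P"
    proof
      fix r assume "r \<in> {..<?m}"
      then have r: "r < ?m" by simp
      show "?g r \<in> carrier ?P"
        unfolding g[OF r] car using x(2,3) r D js eI by (auto intro!: proj_sumI)
    qed
    have delta: "(\<Oplus> r \<in> {..<?m}. if k = r then z r else \<zero>) = z k" if z: "z \<in> carrier ?Q" for z k
    proof (cases "k < ?m")
      case True
      then show ?thesis using D(1)[OF z] by (subst finsum_singleton) auto
    next
      case False
      then have "(\<Oplus> r \<in> {..<?m}. if k = r then z r else \<zero>) = (\<Oplus> r \<in> {..<?m}. \<zero>)"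
        by (intro finsum_cong') auto
      then show ?thesis using False D(3)[OF z] by (simp add: finsum_zero)
    qed
    have "fst (\<Oplus>\<^bsub>?P\<^esub> r \<in> {..<?m}. ?g r) k = x0 k \<and> snd (\<Oplus>\<^bsub>?P\<^esub> r \<in> {..<?m}. ?g r) k = x1 k" for k
    proof
      have "fst (\<Oplus>\<^bsub>?P\<^esub> r \<in> {..<?m}. ?g r) k = (\<Oplus> r \<in> {..<?m}. fst (?g r) k)"
        using gc D(1)
        by (intro additive_finsum[OF P.M.abelian_group_axioms A.abelian_group_axioms,
              where h = "\<lambda>x. fst x k"]) (auto simp: hat_def proj_sum_ops)
      also have "\<dots> = (\<Oplus> r \<in> {..<?m}. if k = r then x0 r else \<zero>)"
        using D(1)[OF x(2)] by (intro finsum_cong') (auto simp: g)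
      finally show "fst (\<Oplus>\<^bsub>?P\<^esub> r \<in> {..<?m}. ?g r) k = x0 k"
        unfolding delta[OF x(2)] .
      have "snd (\<Oplus>\<^bsub>?P\<^esub> r \<in> {..<?m}. ?g r) k = (\<Oplus> r \<in> {..<?m}. snd (?g r) k)"
        using gc D(1)
        by (intro additive_finsum[OF P.M.abelian_group_axioms A.abelian_group_axioms,
              where h = "\<lambda>x. snd x k"]) (auto simp: hat_def proj_sum_ops)
      also have "\<dots> = (\<Oplus> r \<in> {..<?m}. if k = r then x1 r else \<zero>)"
        using D(1)[OF x(3)] by (intro finsum_cong') (auto simp: g)
      finally show "snd (\<Oplus>\<^bsub>?P\<^esub> r \<in> {..<?m}. ?g r) k = x1 k"
        unfolding delta[OF x(3)] .
    qed
    then show "x = (\<Oplus>\<^bsub>?P\<^esub> r \<in> {..<?m}. ?g r)"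
      unfolding x(1) by (simp add: prod_eq_iff fun_eq_iff)
  qed
qed

end

section \<open>Lifting morphisms\<close>

context deformed_algebra_with_idempotents
begin

lemma T_map_closed:
  assumes js: "set js \<subseteq> I" and js': "set js' \<subseteq> I"
    and B: "\<And>l j. \<lbrakk>l < length js; j < length js'\<rbrakk> \<Longrightarrow> B l j \<in> carrier A"
    and x: "x \<in> carrier (proj_sum A e js)"
  shows "T_map A f e js js' B x \<in> carrier (proj_sum A e js')"
proof (rule proj_sumI[OF js'])
  fix j assume j: "j < length js'"
  then have "js' ! j \<in> I" using js' nth_mem by blast
  moreover have "(\<Oplus> l \<in> {..<length js}. f (x l) (B l j)) \<in> carrier A"
    using B j proj_sumD(1)[OF js x] by (intro finsum_closed) (auto intro!: f_closed)
  ultimately show "T_map A f e js js' B x j \<in> carrier A"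
    and "T_map A f e js js' B x j \<otimes> e (js' ! j) = T_map A f e js js' B x j"
    using j by (simp_all add: T_map_def e_closed e_idem m_assoc)
qed (simp add: T_map_def)

lemma T_map_mod_hom:
  assumes js: "set js \<subseteq> I" and js': "set js' \<subseteq> I"
    and B: "\<And>l j. \<lbrakk>l < length js; j < length js'\<rbrakk> \<Longrightarrow> B l j \<in> carrier A"
  shows "T_map A f e js js' B
    \<in> mod_hom K (restrict_scalars A (proj_sum A e js)) (restrict_scalars A (proj_sum A e js'))"
proof (rule mod_homI)
  let ?Q = "restrict_scalars A (proj_sum A e js)" and ?Q' = "restrict_scalars A (proj_sum A e js')"
  let ?T = "T_map A f e js js' B"
  have car: "carrier ?Q = carrier (proj_sum A e js)" "carrier ?Q' = carrier (proj_sum A e js')"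
    by (simp_all add: restrict_scalars_def)
  note D = proj_sumD(1)[OF js]
  have e': "e (js' ! j) \<in> carrier A" if "j < length js'" for j
    using that js' e_closed nth_mem by blast
  have fc: "(\<lambda>l. f (x l) (B l j)) \<in> {..<length js} \<rightarrow> carrier A"
    if "x \<in> carrier ?Q" "j < length js'" for x j
    using that D B by (auto simp: car intro!: f_closed)
  fix x assume x: "x \<in> carrier ?Q"
  show "?T x \<in> carrier ?Q'"
    using x T_map_closed[OF js js' B] by (simp add: car)
  fix y assume y: "y \<in> carrier ?Q"
  show "?T (x \<oplus>\<^bsub>?Q\<^esub> y) = ?T x \<oplus>\<^bsub>?Q'\<^esub> ?T y"
  proof
    fix j
    show "?T (x \<oplus>\<^bsub>?Q\<^esub> y) j = (?T x \<oplus>\<^bsub>?Q'\<^esub> ?T y) j"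
    proof (cases "j < length js'")
      case True
      have "(\<Oplus> l \<in> {..<length js}. f (x l \<oplus> y l) (B l j))
          = (\<Oplus> l \<in> {..<length js}. f (x l) (B l j) \<oplus> f (y l) (B l j))"
        using x y D B True by (intro finsum_cong') (auto simp: car f_add_l f_closed)
      also have "\<dots> = (\<Oplus> l \<in> {..<length js}. f (x l) (B l j)) \<oplus> (\<Oplus> l \<in> {..<length js}. f (y l) (B l j))"
        using fc x y True by (intro finsum_addf) auto
      finally show ?thesis
        using True e' fc[OF x True] fc[OF y True]
        by (simp add: T_map_def restrict_scalars_def proj_sum_ops l_distr finsum_closed)
    qed (simp add: T_map_def restrict_scalars_def proj_sum_ops)
  qed
next
  let ?Q = "restrict_scalars A (proj_sum A e js)" and ?Q' = "restrict_scalars A (proj_sum A e js')"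
  let ?T = "T_map A f e js js' B"
  have car: "carrier ?Q = carrier (proj_sum A e js)"
    by (simp add: restrict_scalars_def)
  note D = proj_sumD(1)[OF js]
  have e': "e (js' ! j) \<in> carrier A" if "j < length js'" for j
    using that js' e_closed nth_mem by blast
  fix c x assume c: "c \<in> carrier K" and x: "x \<in> carrier ?Q"
  show "?T (c \<odot>\<^bsub>?Q\<^esub> x) = c \<odot>\<^bsub>?Q'\<^esub> ?T x"
  proof
    fix j
    show "?T (c \<odot>\<^bsub>?Q\<^esub> x) j = (c \<odot>\<^bsub>?Q'\<^esub> ?T x) j"
    proof (cases "j < length js'")
      case True
      have fc: "(\<lambda>l. f (x l) (B l j)) \<in> {..<length js} \<rightarrow> carrier A"
        using x D B True by (auto simp: car intro!: f_closed)
      have "(\<Oplus> l \<in> {..<length js}. f ((c \<odot> \<one>) \<otimes> x l) (B l j))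
          = (\<Oplus> l \<in> {..<length js}. (c \<odot> \<one>) \<otimes> f (x l) (B l j))"
        using x D B True c
        by (intro finsum_cong') (auto simp: car scal_one_mult f_scal_l f_closed)
      also have "\<dots> = (c \<odot> \<one>) \<otimes> (\<Oplus> l \<in> {..<length js}. f (x l) (B l j))"
        using fc c by (intro finsum_rdistr[symmetric]) auto
      finally show ?thesis
        using True e' fc c
        by (simp add: T_map_def restrict_scalars_def proj_sum_ops m_assoc finsum_closed)
    qed (use c in \<open>simp add: T_map_def restrict_scalars_def proj_sum_ops\<close>)
  qed
qed

text \<open>The failure of \<open>T\<^sub>\<delta>\<close> to be \<open>A\<close>-linear is the sum over \<open>l\<close> of the cocycle identities at \<open>(a, m\<^sub>l, b\<^bsub>lj\<^esub>)\<close>,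
  multiplied by \<open>e'\<^sub>j\<close> from the right. Because \<open>E B E' = B\<close>, the factors \<open>e\<^sub>l\<close> and \<open>e'\<^sub>j\<close> are absorbed by the
  matrix entries.\<close>

lemma hat_morphism_odd:
  assumes js: "set js \<subseteq> I" and js': "set js' \<subseteq> I"
    and fd': "fd_module K A (proj_sum A e js')"
    and \<delta>: "\<delta> \<in> mod_hom A (proj_sum A e js) (proj_sum A e js')"
    and B: "matrix_of A e js js' \<delta> B"
  shows "af_morphism K A (hat A f e js) (hat A f e js') (\<delta>, T_map A f e js js' B, \<delta>)"
proof -
  let ?Q = "proj_sum A e js" and ?Q' = "proj_sum A e js'" and ?S = "{..<length js}"
  let ?T = "T_map A f e js js' B"
  have Q': "left_module A ?Q'" using fd' by (simp add: fd_module_def)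
  interpret Q': left_module A ?Q' by (rule Q')
  note D = proj_sumD[OF js] and D' = proj_sumD[OF js']
  note \<delta>' = mod_homD[OF \<delta>]
  have e: "e (js ! l) \<in> carrier A" "e (js ! l) \<otimes> e (js ! l) = e (js ! l)" if "l < length js" for l
    using that js e_closed e_idem nth_mem by blast+
  have e': "e (js' ! l) \<in> carrier A" "e (js' ! l) \<otimes> e (js' ! l) = e (js' ! l)"
    if "l < length js'" for l
    using that js' e_closed e_idem nth_mem by blast+
  have Bc: "B l j \<in> carrier A" and eBe: "e (js ! l) \<otimes> B l j \<otimes> e (js' ! j) = B l j"
    if "l < length js" "j < length js'" for l j
    using B that by (auto simp: matrix_of_def)
  have eB: "e (js ! l) \<otimes> B l j = B l j" and Be: "B l j \<otimes> e (js' ! j) = B l j"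
    if lj: "l < length js" "j < length js'" for l j
  proof -
    note cl = e[OF lj(1)] e'[OF lj(2)] Bc[OF lj]
    have "e (js ! l) \<otimes> (e (js ! l) \<otimes> B l j \<otimes> e (js' ! j)) = e (js ! l) \<otimes> B l j \<otimes> e (js' ! j)"
      using cl by (simp add: m_assoc[symmetric])
    then show "e (js ! l) \<otimes> B l j = B l j" unfolding eBe[OF lj] .
    have "(e (js ! l) \<otimes> B l j \<otimes> e (js' ! j)) \<otimes> e (js' ! j) = e (js ! l) \<otimes> B l j \<otimes> e (js' ! j)"
      using cl by (simp add: m_assoc)
    then show "B l j \<otimes> e (js' ! j) = B l j" unfolding eBe[OF lj] .
  qed
  have \<delta>B: "\<delta> x j = (\<Oplus> l \<in> ?S. x l \<otimes> B l j)" if "x \<in> carrier ?Q" "j < length js'" for x j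
    using B that by (auto simp: matrix_of_def)
  have "?T (a \<odot>\<^bsub>?Q\<^esub> m)
      = (a \<odot>\<^bsub>?Q'\<^esub> ?T m \<ominus>\<^bsub>?Q'\<^esub> \<delta> (f_proj A f e js a m)) \<oplus>\<^bsub>?Q'\<^esub> f_proj A f e js' a (\<delta> m)" (is "_ = ?R")
    if a: "a \<in> carrier A" and m: "m \<in> carrier ?Q" for a m
  proof
    have expand: "((a \<otimes> y \<oplus> w) \<ominus> z) \<otimes> u = (a \<otimes> (y \<otimes> u) \<ominus> z \<otimes> u) \<oplus> w \<otimes> u"
      if "y \<in> carrier A" "w \<in> carrier A" "z \<in> carrier A" "u \<in> carrier A" for y w z u
      using that a by algebra
    fix j
    have fm: "f_proj A f e js a m \<in> carrier ?Q" using f_proj_closed[OF js a m] .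
    have Tm: "a \<odot>\<^bsub>?Q'\<^esub> ?T m \<in> carrier ?Q'"
      using T_map_closed[OF js js' Bc m] a by (simp add: Q'.smult_closed)
    have R: "?R j = (a \<otimes> ?T m j \<ominus> \<delta> (f_proj A f e js a m) j) \<oplus> f_proj A f e js' a (\<delta> m) j"
      using proj_sum_minus[OF js' Q' Tm \<delta>'(1)[OF fm]] by (simp add: proj_sum_ops)
    show "?T (a \<odot>\<^bsub>?Q\<^esub> m) j = ?R j"
    proof (cases "j < length js'")
      case False
      then show ?thesis
        unfolding R using a D'(3)[OF \<delta>'(1)[OF fm]] by (simp add: T_map_def f_proj_def a_minus_def)
    next
      case True
      let ?u = "e (js' ! j)"
      let ?X = "\<Oplus> l \<in> ?S. f (a \<otimes> m l) (B l j)" and ?Y = "\<Oplus> l \<in> ?S. f (m l) (B l j)"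
        and ?Z = "\<Oplus> l \<in> ?S. f a (m l) \<otimes> B l j" and ?W = "f a (\<delta> m j)"
      have c: "(\<lambda>l. f (a \<otimes> m l) (B l j)) \<in> ?S \<rightarrow> carrier A"
        "(\<lambda>l. f (m l) (B l j)) \<in> ?S \<rightarrow> carrier A"
        "(\<lambda>l. f a (m l) \<otimes> B l j) \<in> ?S \<rightarrow> carrier A"
        "(\<lambda>l. f a (m l \<otimes> B l j)) \<in> ?S \<rightarrow> carrier A"
        "(\<lambda>l. a \<otimes> f (m l) (B l j)) \<in> ?S \<rightarrow> carrier A"
        "(\<lambda>l. m l \<otimes> B l j) \<in> ?S \<rightarrow> carrier A"
        using a D(1)[OF m] Bc True by (auto intro!: f_closed)
      have cl: "?X \<in> carrier A" "?Y \<in> carrier A" "?Z \<in> carrier A" "?W \<in> carrier A" "?u \<in> carrier A"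
        using c a True e' D'(1)[OF \<delta>'(1)[OF m]] by (auto intro!: finsum_closed f_closed)
      \<comment> \<open>the summed cocycle identity, with the negative term moved to the left\<close>
      have "?X \<oplus> ?Z = (\<Oplus> l \<in> ?S. f (a \<otimes> m l) (B l j) \<oplus> f a (m l) \<otimes> B l j)"
        using finsum_addf[OF c(1,3)] by simp
      also have "\<dots> = (\<Oplus> l \<in> ?S. a \<otimes> f (m l) (B l j) \<oplus> f a (m l \<otimes> B l j))"
      proof (rule finsum_cong')
        fix l assume "l \<in> ?S"
        then have "f (m l) (B l j) \<in> carrier A" "f a (m l \<otimes> B l j) \<in> carrier A"
          "f a (m l) \<in> carrier A" "B l j \<in> carrier A" "m l \<in> carrier A"
          using a D(1)[OF m] Bc True by (auto simp: f_closed)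
        then show "f (a \<otimes> m l) (B l j) \<oplus> f a (m l) \<otimes> B l j
            = a \<otimes> f (m l) (B l j) \<oplus> f a (m l \<otimes> B l j)"
          using a by (simp add: f_mult_l a_minus_def a_assoc l_neg)
      qed (use c in auto)
      also have "\<dots> = (\<Oplus> l \<in> ?S. a \<otimes> f (m l) (B l j)) \<oplus> (\<Oplus> l \<in> ?S. f a (m l \<otimes> B l j))"
        using c by (intro finsum_addf) auto
      also have "(\<Oplus> l \<in> ?S. a \<otimes> f (m l) (B l j)) = a \<otimes> ?Y"
        using c a by (intro finsum_rdistr[symmetric]) auto
      also have "(\<Oplus> l \<in> ?S. f a (m l \<otimes> B l j)) = ?W"
        unfolding \<delta>B[OF m True] using c a f_closed f_add_r
        by (intro additive_finsum[OF A.abelian_group_axioms A.abelian_group_axioms, symmetric]) auto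
      finally have XZ: "?X \<oplus> ?Z = a \<otimes> ?Y \<oplus> ?W" .
      have "?X = (?X \<oplus> ?Z) \<ominus> ?Z"
        using cl by (simp add: a_minus_def a_assoc r_neg)
      then have X: "?X = (a \<otimes> ?Y \<oplus> ?W) \<ominus> ?Z"
        unfolding XZ .
      have "\<delta> (f_proj A f e js a m) j = (\<Oplus> l \<in> ?S. f_proj A f e js a m l \<otimes> B l j)"
        by (rule \<delta>B[OF fm True])
      also have "\<dots> = ?Z"
        using c(3) a D(1)[OF m] e Bc[OF _ True] eB[OF _ True]
        by (intro finsum_cong') (auto simp: f_proj_def m_assoc f_closed)
      finally have 1: "\<delta> (f_proj A f e js a m) j = ?Z" .
      have "?Z \<otimes> ?u = (\<Oplus> l \<in> ?S. (f a (m l) \<otimes> B l j) \<otimes> ?u)"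
        using c cl by (intro finsum_ldistr) auto
      also have "\<dots> = ?Z"
        using c(3) a D(1)[OF m] Bc[OF _ True] Be[OF _ True] cl(5)
        by (intro finsum_cong') (auto simp: m_assoc f_closed)
      finally have 2: "?Z \<otimes> ?u = ?Z" .
      have "?T (a \<odot>\<^bsub>?Q\<^esub> m) j = ((a \<otimes> ?Y \<oplus> ?W) \<ominus> ?Z) \<otimes> ?u"
        using True by (simp add: T_map_def proj_sum_ops X)
      also have "\<dots> = (a \<otimes> (?Y \<otimes> ?u) \<ominus> ?Z \<otimes> ?u) \<oplus> ?W \<otimes> ?u"
        by (rule expand[OF cl(2,4,3,5)])
      also have "\<dots> = ?R j"
        unfolding R 1 2 using True by (simp add: T_map_def f_proj_def)
      finally show ?thesis .
    qed
  qed
  then show ?thesis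
    using \<delta> T_map_mod_hom[OF js js' Bc] by (simp add: hat_def)
qed

text \<open>With zero as outer components, the only condition left is that \<open>\<delta>\<close> is \<open>A\<close>-linear.\<close>

lemma hat_morphism_even:
  assumes js: "set js \<subseteq> I" and js': "set js' \<subseteq> I"
    and fd: "fd_module K A (proj_sum A e js)"
    and fd': "fd_module K A (proj_sum A e js')"
    and \<delta>: "\<delta> \<in> mod_hom A (proj_sum A e js) (proj_sum A e js')"
  shows "af_morphism K A (hat A f e js) (hat A f e js')
    (zero_map (proj_sum A e js'), \<delta>, zero_map (proj_sum A e js'))"
proof -
  let ?Q = "proj_sum A e js" and ?Q' = "proj_sum A e js'"
  interpret Q: left_module A ?Q using fd by (simp add: fd_module_def)
  interpret Q': left_module A ?Q' using fd' by (simp add: fd_module_def)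
  have z: "zero_map ?Q' \<in> mod_hom A ?Q ?Q'"
    by (rule zero_mod_hom) (rule Q'.left_module_axioms)
  have "\<delta> (a \<odot>\<^bsub>?Q\<^esub> m) = (a \<odot>\<^bsub>?Q'\<^esub> \<delta> m \<ominus>\<^bsub>?Q'\<^esub> zero_map ?Q' (f_proj A f e js a m))
      \<oplus>\<^bsub>?Q'\<^esub> f_proj A f e js' a (zero_map ?Q' m)"
    if a: "a \<in> carrier A" and m: "m \<in> carrier ?Q" for a m
  proof -
    have "f_proj A f e js' a \<zero>\<^bsub>?Q'\<^esub> = \<zero>\<^bsub>?Q'\<^esub>"
    proof
      fix r
      have "r < length js' \<Longrightarrow> e (js' ! r) \<in> carrier A"
        using js' e_closed nth_mem by blast
      then show "f_proj A f e js' a \<zero>\<^bsub>?Q'\<^esub> r = \<zero>\<^bsub>?Q'\<^esub> r"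
        using a by (simp add: f_proj_def proj_sum_ops f_zero_r)
    qed
    then show ?thesis
      using mod_homD[OF \<delta>] a m by (simp add: zero_map_def a_minus_def Q'.smult_closed)
  qed
  then show ?thesis
    using z mod_hom_restrict_scalars[OF \<delta>] by (simp add: hat_def zero_map_def)
qed

end

context deformed_algebra
begin

lemma left_module_zero_module: "left_module A (zero_module :: ('a, unit) module)"
  by (intro left_module.intro left_module_axioms.intro A.ring_axioms abelian_groupI)
    (auto simp: zero_module_def)

lemma fd_zero_module: "fd_module K A zero_module"
  unfolding fd_module_def
proof
  show "left_module A zero_module" by (rule left_module_zero_module)
  show "finite_dim K (restrict_scalars A zero_module)"
    by (rule finite_dimI[OF left_module_restrict_scalars[OF left_module_zero_module], of "{()}"])
      (auto simp: restrict_scalars_def zero_module_def)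
qed

lemma inflate_object:
  assumes fd: "fd_module K A M"
  shows "af_object K A f (inflate M)"
proof -
  have M: "left_module A M" using fd by (simp add: fd_module_def)
  interpret M: left_module A M by (rule M)
  have minus_zero: "\<ominus>\<^bsub>M\<^esub> \<zero>\<^bsub>M\<^esub> = \<zero>\<^bsub>M\<^esub>" by (rule M.M.minus_equality) simp_all
  have RM: "left_module K (restrict_scalars A M)" by (rule left_module_restrict_scalars[OF M])
  have z: "zero_map M = zero_map (restrict_scalars A M)"
    by (simp add: zero_map_def restrict_scalars_def)
  have "bilinear_map K A (restrict_scalars A zero_module) (restrict_scalars A M) (\<lambda>_. zero_map M)"
    using zero_mod_hom[OF RM, of "restrict_scalars A zero_module"] zero_mod_hom[OF RM, of A]
    unfolding bilinear_map_def z by (simp add: zero_map_def)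
  then show ?thesis
    using fd fd_zero_module zero_mod_hom[OF M, of zero_module]
    by (simp add: inflate_def zero_map_def M.smult_r_null f_closed a_minus_def)
      (simp add: zero_module_def minus_zero)
qed

end

lemma (in deformed_algebra_with_idempotents) augmentation_morphism:
  assumes js: "set js \<subseteq> I" and fd: "fd_module K A (proj_sum A e js)"
    and M: "left_module A M" and \<delta>0: "\<delta>0 \<in> mod_hom A (proj_sum A e js) M"
  shows "af_morphism K A (hat A f e js) (inflate M) (zero_map zero_module, \<delta>0, zero_map M)"
proof -
  interpret M: left_module A M by (rule M)
  show ?thesis
    using zero_mod_hom[OF M, of "proj_sum A e js"]
      zero_mod_hom[OF left_module_zero_module, of "proj_sum A e js"]
      mod_hom_restrict_scalars[OF \<delta>0] mod_homD[OF \<delta>0]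
    by (simp add: hat_def inflate_def zero_map_def M.smult_closed a_minus_def)
qed

section \<open>Exactness and minimality\<close>

text \<open>When \<open>T\<close> is onto, multiplication by \<open>t\<close>, which is \<open>(m\<^sub>0, m\<^sub>1) \<mapsto> (0, T m\<^sub>0)\<close>, sends any submodule that
  projects onto \<open>M\<^sub>0\<close> onto \<open>0 \<times> M\<^sub>1\<close>. Such a submodule is therefore everything, and superfluity can be
  tested on the first component.\<close>

lemma (in deformed_module) superfluous_af_module:
  assumes T_onto: "T ` carrier M0 = carrier M1"
    and S: "superfluous A M0 S"
    and N: "submodule N (af_alg A f) (af_module (M0, M1, T, \<phi>))" and NS: "fst ` N \<subseteq> S"
  shows "superfluous (af_alg A f) (af_module (M0, M1, T, \<phi>)) N"
  unfolding superfluous_def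
proof (intro conjI allI impI N)
  let ?W = "af_module (M0, M1, T, \<phi>)"
  fix L assume L: "submodule L (af_alg A f) ?W" and sum: "L <+>\<^bsub>?W\<^esub> N = carrier ?W"
  note L' = submoduleD[OF L]
  have LM: "m0 \<in> carrier M0" "m1 \<in> carrier M1" if "(m0, m1) \<in> L" for m0 m1
    using L'(1) that by auto
  have "submodule (fst ` L) A M0"
  proof (rule M0.submoduleI)
    show "fst ` L \<subseteq> carrier M0" using L'(1) by auto
    show "\<zero>\<^bsub>M0\<^esub> \<in> fst ` L" using imageI[OF L'(2), of fst] by simp
  next
    fix x y assume "x \<in> fst ` L" "y \<in> fst ` L"
    then obtain x' y' where "(x, x') \<in> L" "(y, y') \<in> L" by auto
    then show "x \<oplus>\<^bsub>M0\<^esub> y \<in> fst ` L"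
      using imageI[OF L'(3)[of "(x, x')" "(y, y')"], of fst] by simp
  next
    fix a x assume a: "a \<in> carrier A" and "x \<in> fst ` L"
    then obtain y where "(x, y) \<in> L" by auto
    then show "a \<odot>\<^bsub>M0\<^esub> x \<in> fst ` L"
      using imageI[OF L'(4)[of "(a, \<zero>)" "(x, y)"], of fst] a by (simp add: af_alg_def)
  qed
  moreover have "fst ` L <+>\<^bsub>M0\<^esub> S = carrier M0"
  proof
    have "S \<subseteq> carrier M0" using S submoduleD(1) by (auto simp: superfluous_def)
    then show "fst ` L <+>\<^bsub>M0\<^esub> S \<subseteq> carrier M0"
      using LM by (auto simp: set_add_def' subset_iff)
    show "carrier M0 \<subseteq> fst ` L <+>\<^bsub>M0\<^esub> S"
    proof
      fix m assume "m \<in> carrier M0"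
      then have "(m, \<zero>\<^bsub>M1\<^esub>) \<in> L <+>\<^bsub>?W\<^esub> N" unfolding sum by simp
      then obtain l n where "l \<in> L" "n \<in> N" "(m, \<zero>\<^bsub>M1\<^esub>) = l \<oplus>\<^bsub>?W\<^esub> n"
        by (auto simp: set_add_def')
      then have "m = fst l \<oplus>\<^bsub>M0\<^esub> fst n" and "fst l \<in> fst ` L" and "fst n \<in> S"
        using NS by (cases l, cases n, auto)+
      then show "m \<in> fst ` L <+>\<^bsub>M0\<^esub> S" unfolding set_add_def' by blast
    qed
  qed
  ultimately have fstL: "fst ` L = carrier M0" using S by (simp add: superfluous_def)
  \<comment> \<open>multiply an element of \<open>L\<close> above \<open>m\<^sub>0\<close> by \<open>t\<close>\<close>
  have zL: "(\<zero>\<^bsub>M0\<^esub>, m1) \<in> L" if "m1 \<in> carrier M1" for m1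
  proof -
    have "m1 \<in> T ` carrier M0" using that T_onto by simp
    then obtain m0 where m0: "m1 = T m0" "m0 \<in> carrier M0" by (rule imageE)
    have "m0 \<in> fst ` L" using m0(2) fstL by simp
    then obtain y where y: "(m0, y) \<in> L" by (rule imageE) (metis prod.collapse)
    have "\<zero> \<odot>\<^bsub>M1\<^esub> y \<oplus>\<^bsub>M1\<^esub> \<one> \<odot>\<^bsub>M1\<^esub> T m0 \<oplus>\<^bsub>M1\<^esub> \<phi> \<zero> m0 = T m0"
      using M1.smult_l_null[OF LM(2)[OF y]] M1.smult_one[OF T_closed[OF m0(2)]] \<phi>_zero[OF m0(2)]
        T_closed[OF m0(2)] by simp
    then have "(\<zero>, \<one>) \<odot>\<^bsub>?W\<^esub> (m0, y) = (\<zero>\<^bsub>M0\<^esub>, m1)"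
      unfolding m0(1) using M0.smult_l_null[OF m0(2)] by simp
    then show ?thesis using L'(4)[OF _ y, of "(\<zero>, \<one>)"] by (simp add: af_alg_def)
  qed
  show "L = carrier ?W"
  proof
    show "L \<subseteq> carrier ?W" by (rule L'(1))
    show "carrier ?W \<subseteq> L"
    proof
      fix x assume "x \<in> carrier ?W"
      then obtain m0 m1 where x: "x = (m0, m1)" "m0 \<in> carrier M0" "m1 \<in> carrier M1" by auto
      have "m0 \<in> fst ` L" using x(2) fstL by simp
      then obtain y where y: "(m0, y) \<in> L" by (rule imageE) (metis prod.collapse)
      have "(m0, y) \<oplus>\<^bsub>?W\<^esub> (\<zero>\<^bsub>M0\<^esub>, m1 \<ominus>\<^bsub>M1\<^esub> y) = x"
        using x LM[OF y] by (simp add: a_minus_def M1.M.a_cancel)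
      then show "x \<in> L" using L'(3)[OF y zL[of "m1 \<ominus>\<^bsub>M1\<^esub> y"]] x LM[OF y] by simp
    qed
  qed
qed

text \<open>To reach \<open>(\<delta> x, z)\<close>, write \<open>z - T x = T k + \<delta> y\<close> with \<open>k \<in> Ker \<delta>\<close>; then \<open>(x + k, y)\<close> is a preimage.\<close>

lemma twisted_map_image:
  assumes "abelian_group Q" and "abelian_group Q'"
    and \<delta>: "\<And>x. x \<in> carrier Q \<Longrightarrow> \<delta> x \<in> carrier Q'"
      "\<And>x y. \<lbrakk>x \<in> carrier Q; y \<in> carrier Q\<rbrakk> \<Longrightarrow> \<delta> (x \<oplus>\<^bsub>Q\<^esub> y) = \<delta> x \<oplus>\<^bsub>Q'\<^esub> \<delta> y"
    and T: "\<And>x. x \<in> carrier Q \<Longrightarrow> T x \<in> carrier Q'"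
      "\<And>x y. \<lbrakk>x \<in> carrier Q; y \<in> carrier Q\<rbrakk> \<Longrightarrow> T (x \<oplus>\<^bsub>Q\<^esub> y) = T x \<oplus>\<^bsub>Q'\<^esub> T y"
    and span: "carrier Q' = T ` a_kernel Q Q' \<delta> <+>\<^bsub>Q'\<^esub> \<delta> ` carrier Q"
  shows "(\<lambda>(x, y). (\<delta> x, T x \<oplus>\<^bsub>Q'\<^esub> \<delta> y)) ` (carrier Q \<times> carrier Q) = \<delta> ` carrier Q \<times> carrier Q'"
proof -
  interpret Q: abelian_group Q by fact
  interpret Q': abelian_group Q' by fact
  have "(\<delta> x, z) \<in> (\<lambda>(x, y). (\<delta> x, T x \<oplus>\<^bsub>Q'\<^esub> \<delta> y)) ` (carrier Q \<times> carrier Q)"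
    if x: "x \<in> carrier Q" and z: "z \<in> carrier Q'" for x z
  proof -
    have "z \<ominus>\<^bsub>Q'\<^esub> T x \<in> carrier Q'" using x z T(1) by simp
    then obtain k y where k: "k \<in> carrier Q" "\<delta> k = \<zero>\<^bsub>Q'\<^esub>" and y: "y \<in> carrier Q"
      and "z \<ominus>\<^bsub>Q'\<^esub> T x = T k \<oplus>\<^bsub>Q'\<^esub> \<delta> y"
      unfolding span by (auto simp: set_add_def' a_kernel_def')
    then have "z = T x \<oplus>\<^bsub>Q'\<^esub> (T k \<oplus>\<^bsub>Q'\<^esub> \<delta> y)"
      using Q'.a_cancel(1)[of "T x" z] x z T(1) by (simp add: a_minus_def)
    then have "(\<delta> x, z) = (\<lambda>(x, y). (\<delta> x, T x \<oplus>\<^bsub>Q'\<^esub> \<delta> y)) (x \<oplus>\<^bsub>Q\<^esub> k, y)"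
      using x k y \<delta> T by (simp add: Q'.a_assoc)
    moreover have "(x \<oplus>\<^bsub>Q\<^esub> k, y) \<in> carrier Q \<times> carrier Q" using x k y by simp
    ultimately show ?thesis by (rule image_eqI)
  qed
  then have "\<delta> ` carrier Q \<times> carrier Q'
      \<subseteq> (\<lambda>(x, y). (\<delta> x, T x \<oplus>\<^bsub>Q'\<^esub> \<delta> y)) ` (carrier Q \<times> carrier Q)"
    by (clarify, rule)
  moreover have "(\<lambda>(x, y). (\<delta> x, T x \<oplus>\<^bsub>Q'\<^esub> \<delta> y)) ` (carrier Q \<times> carrier Q)
      \<subseteq> \<delta> ` carrier Q \<times> carrier Q'"
    using \<delta>(1) T(1) by (intro image_subsetI) (clarsimp simp: imageI)
  ultimately show ?thesis by (rule subset_antisym[rotated])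
qed

text \<open>If \<open>(x, y)\<close> is in the kernel, then \<open>T x = \<delta> (- y)\<close> lies in both summands of the direct sum, so \<open>T x = 0\<close>
  and \<open>x = 0\<close>.\<close>

lemma twisted_map_kernel:
  assumes "abelian_group Q" and "abelian_group Q'"
    and \<delta>: "\<And>x. x \<in> carrier Q \<Longrightarrow> \<delta> x \<in> carrier Q'"
      "\<And>x y. \<lbrakk>x \<in> carrier Q; y \<in> carrier Q\<rbrakk> \<Longrightarrow> \<delta> (x \<oplus>\<^bsub>Q\<^esub> y) = \<delta> x \<oplus>\<^bsub>Q'\<^esub> \<delta> y"
    and T: "\<And>x. x \<in> carrier Q \<Longrightarrow> T x \<in> carrier Q'"
      "\<And>x y. \<lbrakk>x \<in> carrier Q; y \<in> carrier Q\<rbrakk> \<Longrightarrow> T (x \<oplus>\<^bsub>Q\<^esub> y) = T x \<oplus>\<^bsub>Q'\<^esub> T y"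
    and inj: "inj_on T (a_kernel Q Q' \<delta>)"
    and disj: "T ` a_kernel Q Q' \<delta> \<inter> \<delta> ` carrier Q = {\<zero>\<^bsub>Q'\<^esub>}"
  shows "{p \<in> carrier Q \<times> carrier Q. (\<lambda>(x, y). (\<delta> x, T x \<oplus>\<^bsub>Q'\<^esub> \<delta> y)) p = (\<zero>\<^bsub>Q'\<^esub>, \<zero>\<^bsub>Q'\<^esub>)}
    = {\<zero>\<^bsub>Q\<^esub>} \<times> a_kernel Q Q' \<delta>"
proof -
  interpret Q: abelian_group Q by fact
  interpret Q': abelian_group Q' by fact
  have zero: "\<delta> \<zero>\<^bsub>Q\<^esub> = \<zero>\<^bsub>Q'\<^esub>" "T \<zero>\<^bsub>Q\<^esub> = \<zero>\<^bsub>Q'\<^esub>"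
    using additive_zero[OF assms(1,2) \<delta>] additive_zero[OF assms(1,2) T] by simp_all
  have "x = \<zero>\<^bsub>Q\<^esub> \<and> \<delta> y = \<zero>\<^bsub>Q'\<^esub>"
    if x: "x \<in> carrier Q" "\<delta> x = \<zero>\<^bsub>Q'\<^esub>" and y: "y \<in> carrier Q" and xy: "T x \<oplus>\<^bsub>Q'\<^esub> \<delta> y = \<zero>\<^bsub>Q'\<^esub>"
    for x y
  proof -
    have xk: "x \<in> a_kernel Q Q' \<delta>" using x by (simp add: a_kernel_def')
    have "T x = \<delta> (\<ominus>\<^bsub>Q\<^esub> y)"
      using additive_minus[OF assms(1,2) \<delta> y] Q'.minus_equality[OF xy] \<delta>(1) T(1) x y by simp
    moreover have "\<ominus>\<^bsub>Q\<^esub> y \<in> carrier Q" using y by simp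
    ultimately have "T x \<in> T ` a_kernel Q Q' \<delta> \<inter> \<delta> ` carrier Q" using xk by blast
    then have Tx: "T x = \<zero>\<^bsub>Q'\<^esub>" using disj by simp
    moreover have "\<zero>\<^bsub>Q\<^esub> \<in> a_kernel Q Q' \<delta>" using zero by (simp add: a_kernel_def')
    ultimately have "x = \<zero>\<^bsub>Q\<^esub>" using inj_onD[OF inj _ xk, of "\<zero>\<^bsub>Q\<^esub>"] zero by simp
    then show ?thesis using xy Tx \<delta>(1) y by simp
  qed
  then show ?thesis using zero by (auto simp: a_kernel_def')
qed

lemma projective_cover_onto_image:
  assumes "projective K R P" and "h \<in> mod_hom R P Y" and "superfluous R P (a_kernel P Y h)"
  shows "projective_cover K R P (Y\<lparr>carrier := h ` carrier P\<rparr>) h"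
  using assms mod_hom_onto_image by (simp add: projective_cover_def a_kernel_carrier_update)

section \<open>The lifted resolution\<close>

text \<open>In \<open>zero_map zero_module\<close> the scalar type of the zero module is not determined by the type of the map,
  so two occurrences may differ in it. The right-hand side does not mention it.\<close>

lemma zero_map_unit: "zero_map Y = (\<lambda>_. ())"
  by (simp add: fun_eq_iff)

theorem theorem3p11:
  fixes K :: "'k ring"
    and A :: "('k, 'a) module"
    and f :: "'a \<Rightarrow> 'a \<Rightarrow> 'a"
    and n :: nat
    and e :: "nat \<Rightarrow> 'a"
    and M :: "('a, 'm) module"
    and q :: "nat \<Rightarrow> nat list"
    and \<delta> :: "nat \<Rightarrow> (nat \<Rightarrow> 'a) \<Rightarrow> (nat \<Rightarrow> 'a)"
    and \<delta>0 :: "(nat \<Rightarrow> 'a) \<Rightarrow> 'm"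
    and B :: "nat \<Rightarrow> nat \<Rightarrow> nat \<Rightarrow> 'a"
  assumes "algebraically_closed K"
    and "fd_algebra K A"
    and "basic_decomposition K A n e"
    and "hochschild_2_cocycle K A f"
    and "fd_module K A M"
    and "\<And>i. set (q i) \<subseteq> {1..n}"
    and "minimal_projective_resolution K A (\<lambda>i. proj_sum A e (q i)) \<delta> \<delta>0 M"
    and "\<And>i. matrix_of A e (q (i + 1)) (q i) (\<delta> (i + 1)) (B (i + 1))"
    and "condition_star_B A f e q B \<delta> \<delta>0"
  shows "af_minimal_projective_resolution K A f
           (\<lambda>i. hat A f e (q i))
           (\<lambda>i. if even i
                then (zero_map (proj_sum A e (q (i - 1))), \<delta> i, zero_map (proj_sum A e (q (i - 1))))
                else (\<delta> i, T_map A f e (q i) (q (i - 1)) (B i), \<delta> i))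
           (zero_map zero_module, \<delta>0, zero_map M)
           (inflate M)"
proof -
  note q = assms(6) and fdM = assms(5) and mat = assms(8)
  have "idempotent_elt A (e i)" if "i \<in> {1..n}" for i
    using assms(3) that unfolding basic_decomposition_def primitive_idempotent_def by blast
  then interpret deformed_algebra_with_idempotents K A f e "{1..n}"
    using assms(2,4) by unfold_locales
  define Q where "Q i = proj_sum A e (q i)" for i
  define T where "T i = T_map A f e (q i) (q (i - 1)) (B i)" for i
  define H where "H i = af_module (hat A f e (q i))" for i
  define u where "u i = (if even i
                then (zero_map (Q (i - 1)), \<delta> i, zero_map (Q (i - 1)))
                else (\<delta> i, T i, \<delta> i))" for i
  define d where "d i = af_map (hat A f e (q (i - 1))) (u i)" for i
  define u0 :: "(nat \<Rightarrow> 'a, nat \<Rightarrow> 'a, unit, 'm) af_triple"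
    where "u0 = ((\<lambda>_. ()), \<delta>0, zero_map M)"
  define d0 where "d0 = af_map (inflate M) u0"
  let ?N = "af_module (inflate M)"

  have Q_eq: "Q = (\<lambda>i. proj_sum A e (q i))" by (simp add: fun_eq_iff Q_def)
  have covers: "projective_cover K A (Q 0) M \<delta>0"
    "\<And>i. projective_cover K A (Q (i + 1)) (Q i\<lparr>carrier := \<delta> (i + 1) ` carrier (Q (i + 1))\<rparr>) (\<delta> (i + 1))"
    and resolution: "projective_resolution K A Q \<delta> \<delta>0 M"
    using assms(7) by (simp_all add: minimal_projective_resolution_def Q_eq)
  have fdQ: "fd_module K A (Q i)" for i
    using resolution by (simp add: projective_resolution_def projective_def)
  have fdQ': "fd_module K A (proj_sum A e (q i))" for i
    using fdQ by (simp add: Q_def)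
  have ab: "abelian_group (Q i)" for i
    using fdQ[of i] by (simp add: fd_module_def left_module_def)
  have M: "left_module A M" using fdM by (simp add: fd_module_def)
  interpret M: left_module A M by (rule M)
  interpret Q: left_module A "Q i" for i
    using fdQ[of i] by (simp add: fd_module_def)
  have \<delta>_hom: "\<delta> (i + 1) \<in> mod_hom A (Q (i + 1)) (Q i)" and \<delta>0_hom: "\<delta>0 \<in> mod_hom A (Q 0) M" for i
    using resolution by (simp_all add: projective_resolution_def)
  have exact: "\<delta>0 ` carrier (Q 0) = carrier M"
    "\<delta> 1 ` carrier (Q 1) = a_kernel (Q 0) M \<delta>0"
    "\<delta> (i + 2) ` carrier (Q (i + 2)) = a_kernel (Q (i + 1)) (Q i) (\<delta> (i + 1))" for i
    using resolution by (simp_all add: projective_resolution_def)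

  have obj: "af_object K A f (hat A f e (q i))" for i
    by (rule hat_object[OF q fdQ'])
  have objM: "af_object K A f (inflate M)"
    by (rule inflate_object[OF fdM])
  have mor: "af_morphism K A (hat A f e (q (i + 1))) (hat A f e (q i)) (u (i + 1))" for i
    using hat_morphism_odd[OF q q fdQ' _ mat] hat_morphism_even[OF q q fdQ' fdQ'] \<delta>_hom[of i]
    by (simp add: u_def T_def Q_def)
  have mor0: "af_morphism K A (hat A f e (q 0)) (inflate M) u0"
    using augmentation_morphism[OF q fdQ' M] \<delta>0_hom by (simp add: u0_def Q_def zero_map_unit)
  have hom: "d (i + 1) \<in> mod_hom (af_alg A f) (H (i + 1)) (H i)" for i
    using af_map_mod_hom[OF obj obj mor[of i]] by (simp add: d_def H_def)
  have hom0: "d0 \<in> mod_hom (af_alg A f) (H 0) ?N"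
    using af_map_mod_hom[OF obj objM mor0] by (simp add: d0_def H_def)
  have proj: "projective K (af_alg A f) (H i)" for i
    unfolding H_def by (rule projective_hat[OF q fdQ'])
  have lm: "left_module (af_alg A f) (H i)" for i
    using proj by (simp add: projective_def fd_module_def)
  have fdN: "fd_module K (af_alg A f) ?N"
  proof -
    interpret deformed_module K A f zero_module M "zero_map M" "\<lambda>_. zero_map M"
      using objM by unfold_locales (simp add: inflate_def)
    show ?thesis using fd_module_af_module by (simp add: inflate_def)
  qed
  have lmN: "left_module (af_alg A f) ?N" using fdN by (simp add: fd_module_def)

  have carH: "carrier (H i) = carrier (Q i) \<times> carrier (Q i)"
    and zeroH: "\<zero>\<^bsub>H i\<^esub> = (\<zero>\<^bsub>Q i\<^esub>, \<zero>\<^bsub>Q i\<^esub>)" for i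
    by (simp_all add: H_def hat_def Q_def)
  have d_even: "d (i + 1) (x, y) = (\<zero>\<^bsub>Q i\<^esub>, \<delta> (i + 1) x)"
    if "odd i" "x \<in> carrier (Q (i + 1))" for i x y
    using that mod_homD(1)[OF \<delta>_hom[of i]] Q.M.r_zero[of _ i]
    by (simp add: d_def u_def hat_def zero_map_def flip: Q_def)
  have d_odd: "d (i + 1) = (\<lambda>(x, y). (\<delta> (i + 1) x, T (i + 1) x \<oplus>\<^bsub>Q i\<^esub> \<delta> (i + 1) y))"
    if "even i" for i
    using that by (auto simp: fun_eq_iff d_def u_def hat_def simp flip: Q_def)
  have d0: "d0 (x, y) = ((), \<delta>0 x)" if "x \<in> carrier (Q 0)" for x y
    using that mod_homD(1)[OF \<delta>0_hom]
    by (simp add: d0_def u0_def inflate_def zero_map_def)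

  have T_hom: "T (i + 1) \<in> mod_hom K (restrict_scalars A (Q (i + 1))) (restrict_scalars A (Q i))" for i
    using mat[of i] unfolding T_def Q_def diff_add_inverse2
    by (intro T_map_mod_hom q) (auto simp: matrix_of_def)
  have T_closed: "T (i + 1) x \<in> carrier (Q i)" if "x \<in> carrier (Q (i + 1))" for i x
    using mod_homD(1)[OF T_hom] that by (simp add: restrict_scalars_def)
  have T_add: "T (i + 1) (x \<oplus>\<^bsub>Q (i + 1)\<^esub> y) = T (i + 1) x \<oplus>\<^bsub>Q i\<^esub> T (i + 1) y"
    if "x \<in> carrier (Q (i + 1))" "y \<in> carrier (Q (i + 1))" for i x y
    using mod_homD(2)[OF T_hom] that by (simp add: restrict_scalars_def)
  have star: "inj_on (T (i + 1)) (a_kernel (Q (i + 1)) (Q i) (\<delta> (i + 1)))"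
    "carrier (Q i) = T (i + 1) ` a_kernel (Q (i + 1)) (Q i) (\<delta> (i + 1)) <+>\<^bsub>Q i\<^esub>
      \<delta> (i + 1) ` carrier (Q (i + 1))"
    "T (i + 1) ` a_kernel (Q (i + 1)) (Q i) (\<delta> (i + 1)) \<inter> \<delta> (i + 1) ` carrier (Q (i + 1))
      = {\<zero>\<^bsub>Q i\<^esub>}"
    if i: "even i" for i
  proof -
    obtain j where j: "i = 2 * j" using i by blast
    note * = assms(9)[unfolded condition_star_B_def Let_def, folded Q_def T_def, rule_format, of j]
    \<comment> \<open>injectivity of \<open>\<delta> T\<close> on the kernel gives that of \<open>T\<close>; for \<open>j = 0\<close> the augmentation is in place of \<open>\<delta>\<close>\<close>
    show "inj_on (T (i + 1)) (a_kernel (Q (i + 1)) (Q i) (\<delta> (i + 1)))"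
      using * unfolding j by (cases "j = 0") (auto simp: inj_on_def)
    show "carrier (Q i) = T (i + 1) ` a_kernel (Q (i + 1)) (Q i) (\<delta> (i + 1)) <+>\<^bsub>Q i\<^esub>
      \<delta> (i + 1) ` carrier (Q (i + 1))"
      and "T (i + 1) ` a_kernel (Q (i + 1)) (Q i) (\<delta> (i + 1)) \<inter> \<delta> (i + 1) ` carrier (Q (i + 1))
      = {\<zero>\<^bsub>Q i\<^esub>}"
      using * unfolding j by simp_all
  qed

  have im_even: "d (i + 1) ` carrier (H (i + 1)) = {\<zero>\<^bsub>Q i\<^esub>} \<times> \<delta> (i + 1) ` carrier (Q (i + 1))"
    if "odd i" for i
  proof
    show "d (i + 1) ` carrier (H (i + 1)) \<subseteq> {\<zero>\<^bsub>Q i\<^esub>} \<times> \<delta> (i + 1) ` carrier (Q (i + 1))"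
      by (auto simp: carH d_even[OF that, simplified])
    show "{\<zero>\<^bsub>Q i\<^esub>} \<times> \<delta> (i + 1) ` carrier (Q (i + 1)) \<subseteq> d (i + 1) ` carrier (H (i + 1))"
    proof clarify
      fix x assume "x \<in> carrier (Q (i + 1))"
      then show "(\<zero>\<^bsub>Q i\<^esub>, \<delta> (i + 1) x) \<in> d (i + 1) ` carrier (H (i + 1))"
        using d_even[OF that, of x x]
        by (intro image_eqI[of _ _ "(x, x)"]) (simp_all add: carH)
    qed
  qed
  have ker_even: "a_kernel (H (i + 1)) (H i) (d (i + 1))
      = a_kernel (Q (i + 1)) (Q i) (\<delta> (i + 1)) \<times> carrier (Q (i + 1))" if "odd i" for i
    by (auto simp: a_kernel_def' carH zeroH d_even[OF that, simplified])
  have im_odd: "d (i + 1) ` carrier (H (i + 1)) = \<delta> (i + 1) ` carrier (Q (i + 1)) \<times> carrier (Q i)"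
    if "even i" for i
    unfolding d_odd[OF that] carH
    by (rule twisted_map_image[OF ab ab mod_homD(1,2)[OF \<delta>_hom] T_closed T_add star(2)[OF that]])
  have ker_odd: "a_kernel (H (i + 1)) (H i) (d (i + 1))
      = {\<zero>\<^bsub>Q (i + 1)\<^esub>} \<times> a_kernel (Q (i + 1)) (Q i) (\<delta> (i + 1))" if "even i" for i
    unfolding a_kernel_def'[of "H (i + 1)"] d_odd[OF that] carH zeroH
    by (rule twisted_map_kernel[OF ab ab mod_homD(1,2)[OF \<delta>_hom] T_closed T_add star(1,3)[OF that]])
  have ker0: "a_kernel (H 0) ?N d0 = a_kernel (Q 0) M \<delta>0 \<times> carrier (Q 0)"
    by (auto simp: a_kernel_def' carH d0 inflate_def zero_module_def)

  have sup: "superfluous (af_alg A f) (H i) N"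
    if "superfluous A (Q i) S" "submodule N (af_alg A f) (H i)" "fst ` N \<subseteq> S" for i S N
  proof -
    interpret deformed_module K A f "Q i" "Q i" "\<lambda>x. x" "f_proj A f e (q i)"
      using obj[of i] by unfold_locales (simp add: hat_def Q_def)
    show ?thesis
      using superfluous_af_module[of S N] that by (simp add: H_def hat_def Q_def)
  qed
  have cover0: "projective_cover K (af_alg A f) (H 0) ?N d0"
    unfolding projective_cover_def
  proof (intro conjI proj hom0)
    show "d0 ` carrier (H 0) = carrier ?N"
    proof
      show "d0 ` carrier (H 0) \<subseteq> carrier ?N"
        using mod_homD(1)[OF hom0] by auto
      show "carrier ?N \<subseteq> d0 ` carrier (H 0)"
      proof
        fix p assume "p \<in> carrier ?N"
        then obtain x where "x \<in> carrier (Q 0)" "p = ((), \<delta>0 x)"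
          by (auto simp: inflate_def simp flip: exact(1))
        then show "p \<in> d0 ` carrier (H 0)"
          by (intro image_eqI[of _ _ "(x, x)"]) (simp_all add: carH d0)
      qed
    qed
    show "superfluous (af_alg A f) (H 0) (a_kernel (H 0) ?N d0)"
    proof (rule sup)
      show "superfluous A (Q 0) (a_kernel (Q 0) M \<delta>0)"
        using covers(1) by (simp add: projective_cover_def)
      show "submodule (a_kernel (H 0) ?N d0) (af_alg A f) (H 0)"
        by (rule submodule_a_kernel[OF lm lmN hom0])
    qed (auto simp: ker0)
  qed
  have cover: "projective_cover K (af_alg A f) (H (i + 1))
      (H i\<lparr>carrier := d (i + 1) ` carrier (H (i + 1))\<rparr>) (d (i + 1))" for i
  proof (rule projective_cover_onto_image[OF proj hom], rule sup)
    show "superfluous A (Q (i + 1)) (a_kernel (Q (i + 1)) (Q i) (\<delta> (i + 1)))"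
      using covers(2)[of i] by (simp add: projective_cover_def a_kernel_carrier_update)
    show "submodule (a_kernel (H (i + 1)) (H i) (d (i + 1))) (af_alg A f) (H (i + 1))"
      by (rule submodule_a_kernel[OF lm lm hom])
    have "\<zero>\<^bsub>Q (i + 1)\<^esub> \<in> a_kernel (Q (i + 1)) (Q i) (\<delta> (i + 1))"
      using submoduleD(2)[OF submodule_a_kernel[OF Q.left_module_axioms Q.left_module_axioms \<delta>_hom]] .
    then show "fst ` a_kernel (H (i + 1)) (H i) (d (i + 1)) \<subseteq> a_kernel (Q (i + 1)) (Q i) (\<delta> (i + 1))"
      using ker_even[of i] ker_odd[of i] by (cases "even i") auto
  qed
  have "d 1 ` carrier (H 1) = a_kernel (H 0) ?N d0"
    using im_odd[of 0] exact(2) by (simp add: ker0)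
  moreover have "d (i + 2) ` carrier (H (i + 2)) = a_kernel (H (i + 1)) (H i) (d (i + 1))" for i
    using im_odd[of "i + 1"] im_even[of "i + 1"] ker_odd[of i] ker_even[of i] exact(3)[of i]
    by (cases "even i") simp_all
  ultimately have "minimal_projective_resolution K (af_alg A f) H d d0 ?N"
    using fdN proj hom hom0 cover0 cover
    by (simp add: minimal_projective_resolution_def projective_resolution_def projective_cover_def)
  then show ?thesis
    using obj objM mor mor0
    unfolding af_minimal_projective_resolution_def u_def d_def d0_def u0_def H_def T_def Q_def
      zero_map_unit
    by blast
qed

end
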